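(* Let $n\ge 2$, let $\mathrm{KVJ}_n$ be the kernel of $\pi_K:\mathrm{VJ}_n\to\mathfrak S_n$, and let $\Gamma$ be the trickle graph with vertex set $V=\bigcup_{\ell=2}^nV_\ell$ defined in the context. Then the homomorphism $\Phi: \mathrm{Tr} (\Gamma) \to \mathrm{KVJ}_n$ which sends $y$ to $\delta_y$ for all $y\in V$ is an isomorphism.
   Context: **Trickle graphs.** For a simplicial graph $\Gamma$ with vertex set $V(\Gamma)$ and edge set $E(\Gamma)$, $\mathrm{star}_x(\Gamma)$ is the full subgraph spanned by $x$ and all vertices adjacent to $x$. A trickle graph is a quadruple $(\Gamma,\le,\mu,(\varphi_x)_{x\in V(\Gamma)})$ where $\Gamma$ is a simplicial graph, $\le$ is a partial order on $V(\Gamma)$, $\mu:V(\Gamma)\to\mathbb N_{\ge 2}\cup\{\infty\}$ is a labeling, and each $\varphi_x$ is a graph automorphism of $\mathrm{star}_x(\Gamma)$, such that, writing $x||y$ if $x\not\le y$ and $y\not\le x$, and $E_{||}(\Gamma)=\{\{x,y\}\in E(\Gamma)\mid x||y\}$: (a) if $x<y$ then $\{x,y\}\in E(\Gamma)$; (b) if $\{x,y\}\in E_{||}(\Gamma)$ and $z\le y$, then $\{x,z\}\in E_{||}(\Gamma)$; (c) for $y,z\in \mathrm{star}_x(\Gamma)$: $z\le y$ iff $\varphi_x(z)\le\varphi_x(y)$; (d) for $y\in\mathrm{star}_x(\Gamma)$: if $\varphi_x(y)\ne y$ then $y<x$; (e) if $\mu(x)$ is finite, then $\varphi_x$ has finite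 order dividing $\mu(x)$; (f) $\mu(\varphi_x(y))=\mu(y)$ for $y\in \mathrm{star}_x(\Gamma)$; (g) if $z<y<x$ then $(\varphi_x\circ\varphi_y)(z)=(\varphi_{y'}\circ\varphi_x)(z)$ where $y'=\varphi_x(y)$. The trickle group is $\mathrm{Tr}(\Gamma)=\langle V(\Gamma)\mid x^{\mu(x)}=1 \text{ if }\mu(x)\ne\infty,\ \varphi_x(y)\,x=\varphi_y(x)\,y\text{ for }\{x,y\}\in E(\Gamma)\rangle$. **Virtual cactus group.** $\mathrm{VJ}_n$ is the group with generators $x_{p,q}$ ($1\le p<q\le n$) and $\rho_i$ ($1\le i\le n-1$) and relations: $x_{p,q}^2=1$; $x_{p,q}x_{m,r}=x_{m,r}x_{p,q}$ if $[p,q]\cap[m,r]=\emptyset$; $x_{p,q}x_{m,r}=x_{p+q-r,p+q-m}x_{p,q}$ if $[m,r]\subset[p,q]$; $\rho_i^2=1$; $\rho_i\rho_j\rho_i=\rho_j\rho_i\rho_j$ if $|i-j|=1$; $\rho_i\rho_j=\rho_j\rho_i$ if $|i-j|>1$; $\rho_ix_{p,q}=x_{p,q}\rho_i$ if $i<p-1$ or $i\ge q+1$; $x_{p,q}\rho_q\rho_{q-1}\cdots\rho_p=\rho_q\rho_{q-1}\cdots\rho_p\,x_{p+1,q+1}$ for $1\le p<q<n$. $\mathfrak S_n$ is the symmetric group on $\{1,\dots,n\}$ and $s_i=(i,i+1)$. $\iota_S:\mathfrak S_n\to\mathrm{VJ}_n$ is the homomorphism $s_i\mapsto\rho_i$,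 and $\pi_K:\mathrm{VJ}_n\to\mathfrak S_n$ is the homomorphism with $\pi_K(x_{p,q})=1$, $\pi_K(\rho_i)=s_i$. $\mathrm{KVJ}_n=\mathrm{Ker}(\pi_K)$. **The elements $\delta_y$ and the graph.** For $2\le\ell\le n$, $V_\ell=\{(t_1,\dots,t_\ell)\in\{1,\dots,n\}^\ell\mid t_i\ne t_j\text{ for }i\neq j\}$. For $y=(t_1,\dots,t_\ell)\in V_\ell$, $\delta_y=\iota_S(w)\,x_{1,\ell}\,\iota_S(w)^{-1}\in\mathrm{KVJ}_n$, where $w\in\mathfrak S_n$ is any permutation with $w(i)=t_i$ for $1\le i\le\ell$ (independent of the choice of $w$). The trickle graph $\Gamma$ has vertex set $V=\bigcup_{\ell=2}^nV_\ell$; $\mu(y)=2$ for all $y$; for $y=(t_1,\dots,t_\ell)$, $y'\le y$ iff $y'=(t_p,t_{p+1},\dots,t_q)$ for some $1\le p<q\le\ell$; distinct $y=(t_1,\dots,t_\ell)$ and $y'=(t'_1,\dots,t'_k)$ are adjacent iff $y\le y'$ or $y'\le y$ or $\{t_1,\dots,t_\ell\}\cap\{t'_1,\dots,t'_k\}=\emptyset$; for $y=(t_1,\dots,t_\ell)$ and $y'\in\mathrm{star}_y(\Gamma)$, $\varphi_y(y')=y'$ if $y'\not\le y$, and $\varphi_y(y')=(t_{1+\ell-q},\dots,t_{1+\ell-p})$ if $y'=(t_p,\dots,t_q)\le y$. This is a trickle graph, and $y\mapsto\delta_y$ does define a homomorphism $\Phi:\mathrm{Tr}(\Gamma)\to\mathrm{KVJ}_n$.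 *)

theory Defs
  imports
    "HOL-Algebra.Sym_Groups"
    "HOL-Algebra.Bij"
    "HOL-Algebra.Multiplicative_Group"
    "HOL-Library.Extended_Nat"
begin

section \<open>Groups given by generators and relations\<close>

text \<open>The letter \<open>(a, True)\<close> stands for the generator \<open>a\<close> and \<open>(a, False)\<close> for its
  formal inverse.  A pair \<open>(u, v)\<close> of words stands for the relation \<open>u = v\<close>.\<close>

type_synonym 'a word = "('a \<times> bool) list"

definition words :: "'a set \<Rightarrow> 'a word set" where
  "words X = lists (X \<times> UNIV)"

definition pos_word :: "'a list \<Rightarrow> 'a word" where
  "pos_word as = map (\<lambda>a. (a, True)) as"

inductive word_eq :: "'a set \<Rightarrow> ('a word \<times> 'a word) set \<Rightarrow> 'a word \<Rightarrow> 'a word \<Rightarrow> bool"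
  for X R where
  refl: "u \<in> words X \<Longrightarrow> word_eq X R u u"
| sym: "word_eq X R u v \<Longrightarrow> word_eq X R v u"
| trans: "word_eq X R u v \<Longrightarrow> word_eq X R v w \<Longrightarrow> word_eq X R u w"
| append: "word_eq X R u v \<Longrightarrow> word_eq X R u' v' \<Longrightarrow> word_eq X R (u @ u') (v @ v')"
| cancel: "a \<in> X \<Longrightarrow> word_eq X R [(a, b), (a, \<not> b)] []"
| relation: "(u, v) \<in> R \<Longrightarrow> u \<in> words X \<Longrightarrow> v \<in> words X \<Longrightarrow> word_eq X R u v"

definition word_class :: "'a set \<Rightarrow> ('a word \<times> 'a word) set \<Rightarrow> 'a word \<Rightarrow> 'a word set" where
  "word_class X R u = {v. word_eq X R u v}"

definition presented_group :: "'a set \<Rightarrow> ('a word \<times> 'a word) set \<Rightarrow> 'a word set monoid" where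
  "presented_group X R =
    \<lparr> carrier = word_class X R ` words X,
      mult = (\<lambda>A B. {w. \<exists>u\<in>A. \<exists>v\<in>B. word_eq X R (u @ v) w}),
      one = word_class X R [] \<rparr>"

definition pres_gen :: "'a set \<Rightarrow> ('a word \<times> 'a word) set \<Rightarrow> 'a \<Rightarrow> 'a word set" where
  "pres_gen X R a = word_class X R [(a, True)]"

text \<open>The homomorphism \<open>G \<rightarrow> H\<close> sending \<open>g i\<close> to \<open>f i\<close> for all \<open>i \<in> I\<close>.  It is only meaningful
  if there is exactly one; uniqueness is automatic when the \<open>g i\<close> generate \<open>G\<close>, as in all uses
  below.\<close>

definition the_hom :: "('a, 'm) monoid_scheme \<Rightarrow> ('b, 'k) monoid_scheme \<Rightarrow>
    'i set \<Rightarrow> ('i \<Rightarrow> 'a) \<Rightarrow> ('i \<Rightarrow> 'b) \<Rightarrow> 'a \<Rightarrow> 'b" where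
  "the_hom G H I g f =
    (THE h. h \<in> hom G H \<and> h \<in> extensional (carrier G) \<and> (\<forall>i\<in>I. h (g i) = f i))"

lemma word_eq_in_words:
  "word_eq X R u v \<Longrightarrow> u \<in> words X \<and> v \<in> words X"
  by (induction rule: word_eq.induct) (auto simp: words_def)

lemma word_class_eq_iff:
  assumes "u \<in> words X"
  shows "word_class X R u = word_class X R v \<longleftrightarrow> word_eq X R u v"
  using assms unfolding word_class_def
  by (auto intro: word_eq.refl word_eq.sym word_eq.trans dest: word_eq.refl)

lemma mult_word_class:
  assumes "u \<in> words X" "v \<in> words X"
  shows "word_class X R u \<otimes>\<^bsub>presented_group X R\<^esub> word_class X R v = word_class X R (u @ v)"
  using assms unfolding word_class_def presented_group_def
  by (auto intro: word_eq.trans word_eq.append word_eq.refl)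

lemma word_eq_inverse:
  "u \<in> words X \<Longrightarrow> word_eq X R (rev (map (\<lambda>(a, b). (a, \<not> b)) u) @ u) []"
proof (induction u)
  case Nil
  then show ?case by (simp add: word_eq.refl)
next
  case (Cons l u)
  obtain a b where l: "l = (a, b)" by (cases l)
  let ?u' = "rev (map (\<lambda>(a, b). (a, \<not> b)) u)"
  have a: "a \<in> X" and u: "u \<in> words X" using Cons.prems by (auto simp: l words_def)
  have u': "?u' \<in> words X" using u by (fastforce simp: words_def)
  have "word_eq X R ([(a, \<not> b), (a, \<not> \<not> b)] @ u) ([] @ u)"
    using a u by (intro word_eq.append word_eq.cancel word_eq.refl)
  then have "word_eq X R (?u' @ ([(a, \<not> b), (a, \<not> \<not> b)] @ u)) (?u' @ ([] @ u))"
    by (rule word_eq.append[OF word_eq.refl[OF u']])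
  then show ?case using Cons.IH[OF u] by (auto simp: l intro: word_eq.trans)
qed

lemma group_presented_group: "group (presented_group X R)"
proof (rule groupI)
  let ?G = "presented_group X R"
  have carr: "\<And>A. A \<in> carrier ?G \<longleftrightarrow> (\<exists>u\<in>words X. A = word_class X R u)"
    by (auto simp: presented_group_def)
  have one: "\<one>\<^bsub>?G\<^esub> = word_class X R []" by (simp add: presented_group_def)
  have app: "\<And>u v. u \<in> words X \<Longrightarrow> v \<in> words X \<Longrightarrow> u @ v \<in> words X"
    by (simp add: words_def)
  have nil: "[] \<in> words X" by (simp add: words_def)
  show "\<one>\<^bsub>?G\<^esub> \<in> carrier ?G" using nil by (auto simp: one carr)
  fix A assume "A \<in> carrier ?G"
  then obtain u where u: "u \<in> words X" "A = word_class X R u" by (auto simp: carr)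
  show "\<one>\<^bsub>?G\<^esub> \<otimes>\<^bsub>?G\<^esub> A = A" using u nil by (simp add: one mult_word_class)
  show "\<exists>B\<in>carrier ?G. B \<otimes>\<^bsub>?G\<^esub> A = \<one>\<^bsub>?G\<^esub>"
  proof
    let ?u' = "rev (map (\<lambda>(a, b). (a, \<not> b)) u)"
    have u': "?u' \<in> words X" using u(1) by (fastforce simp: words_def)
    show "word_class X R ?u' \<in> carrier ?G" using u' by (auto simp: carr)
    show "word_class X R ?u' \<otimes>\<^bsub>?G\<^esub> A = \<one>\<^bsub>?G\<^esub>"
      using word_eq_inverse[OF u(1), of R] u u' app[OF u' u(1)]
      by (simp add: one mult_word_class word_class_eq_iff)
  qed
  fix B assume "B \<in> carrier ?G"
  then obtain v where v: "v \<in> words X" "B = word_class X R v" by (auto simp: carr)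
  show "A \<otimes>\<^bsub>?G\<^esub> B \<in> carrier ?G" using u v app by (auto simp: mult_word_class carr)
  fix C assume "C \<in> carrier ?G"
  then obtain w where w: "w \<in> words X" "C = word_class X R w" by (auto simp: carr)
  show "A \<otimes>\<^bsub>?G\<^esub> B \<otimes>\<^bsub>?G\<^esub> C = A \<otimes>\<^bsub>?G\<^esub> (B \<otimes>\<^bsub>?G\<^esub> C)"
    using u v w app by (simp add: mult_word_class)
qed

section \<open>Trickle graphs and trickle groups\<close>

record 'v trickle_data =
  verts :: "'v set"
  edges :: "'v set set"
  ordr :: "('v \<times> 'v) set"
  label :: "'v \<Rightarrow> enat"
  aut :: "'v \<Rightarrow> 'v \<Rightarrow> 'v"

definition star :: "'v trickle_data \<Rightarrow> 'v \<Rightarrow> 'v set" where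
  "star T x = insert x {y \<in> verts T. {x, y} \<in> edges T}"

definition par_edges :: "'v trickle_data \<Rightarrow> 'v set set" where
  "par_edges T = {{x, y} | x y. {x, y} \<in> edges T \<and> (x, y) \<notin> ordr T \<and> (y, x) \<notin> ordr T}"

locale trickle_graph =
  fixes T :: "'v trickle_data"
  assumes simplicial: "e \<in> edges T \<Longrightarrow> \<exists>x\<in>verts T. \<exists>y\<in>verts T. x \<noteq> y \<and> e = {x, y}"
    and partial_order: "partial_order_on (verts T) (ordr T)"
    and label_ge_2: "x \<in> verts T \<Longrightarrow> 2 \<le> label T x"
    and aut_bij: "x \<in> verts T \<Longrightarrow> bij_betw (aut T x) (star T x) (star T x)"
    and aut_edges: "\<lbrakk>x \<in> verts T; y \<in> star T x; z \<in> star T x\<rbrakk> \<Longrightarrow>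
      {aut T x y, aut T x z} \<in> edges T \<longleftrightarrow> {y, z} \<in> edges T"
    and ax_a: "\<lbrakk>(x, y) \<in> ordr T; x \<noteq> y\<rbrakk> \<Longrightarrow> {x, y} \<in> edges T"
    and ax_b: "\<lbrakk>{x, y} \<in> par_edges T; (z, y) \<in> ordr T\<rbrakk> \<Longrightarrow> {x, z} \<in> par_edges T"
    and ax_c: "\<lbrakk>x \<in> verts T; y \<in> star T x; z \<in> star T x\<rbrakk> \<Longrightarrow>
      (z, y) \<in> ordr T \<longleftrightarrow> (aut T x z, aut T x y) \<in> ordr T"
    and ax_d: "\<lbrakk>x \<in> verts T; y \<in> star T x; aut T x y \<noteq> y\<rbrakk> \<Longrightarrow> (y, x) \<in> ordr T \<and> y \<noteq> x"
    \<comment> \<open>\<open>group.ord\<close> is 0 for elements of infinite order, and 0 does not divide \<open>m \<ge> 2\<close>.\<close>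
    and ax_e: "\<lbrakk>x \<in> verts T; label T x = enat m\<rbrakk> \<Longrightarrow>
      group.ord (BijGroup (star T x)) (restrict (aut T x) (star T x)) dvd m"
    and ax_f: "\<lbrakk>x \<in> verts T; y \<in> star T x\<rbrakk> \<Longrightarrow> label T (aut T x y) = label T y"
    and ax_g: "\<lbrakk>(z, y) \<in> ordr T; z \<noteq> y; (y, x) \<in> ordr T; y \<noteq> x\<rbrakk> \<Longrightarrow>
      aut T x (aut T y z) = aut T (aut T x y) (aut T x z)"

definition trickle_rels :: "'v trickle_data \<Rightarrow> ('v word \<times> 'v word) set" where
  "trickle_rels T =
     {(pos_word (replicate m x), []) | x m. x \<in> verts T \<and> label T x = enat m}
   \<union> {(pos_word [aut T x y, x], pos_word [aut T y x, y]) | x y. {x, y} \<in> edges T}"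

definition trickle_group :: "'v trickle_data \<Rightarrow> 'v word set monoid" where
  "trickle_group T = presented_group (verts T) (trickle_rels T)"

definition trickle_gen :: "'v trickle_data \<Rightarrow> 'v \<Rightarrow> 'v word set" where
  "trickle_gen T = pres_gen (verts T) (trickle_rels T)"

section \<open>The virtual cactus group\<close>

datatype vj_letter = X nat nat | Rho nat

definition vj_letters :: "nat \<Rightarrow> vj_letter set" where
  "vj_letters n = {X p q | p q. 1 \<le> p \<and> p < q \<and> q \<le> n} \<union> {Rho i | i. 1 \<le> i \<and> i \<le> n - 1}"

definition vj_rels :: "nat \<Rightarrow> (vj_letter word \<times> vj_letter word) set" where
  "vj_rels n =
     {(pos_word [X p q, X p q], []) | p q. 1 \<le> p \<and> p < q \<and> q \<le> n}
   \<union> {(pos_word [X p q, X m r], pos_word [X m r, X p q]) | p q m r.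
        1 \<le> p \<and> p < q \<and> q \<le> n \<and> 1 \<le> m \<and> m < r \<and> r \<le> n \<and> {p..q} \<inter> {m..r} = {}}
   \<union> {(pos_word [X p q, X m r], pos_word [X (p + q - r) (p + q - m), X p q]) | p q m r.
        1 \<le> p \<and> p < q \<and> q \<le> n \<and> 1 \<le> m \<and> m < r \<and> r \<le> n \<and> {m..r} \<subseteq> {p..q}}
   \<union> {(pos_word [Rho i, Rho i], []) | i. 1 \<le> i \<and> i \<le> n - 1}
   \<union> {(pos_word [Rho i, Rho j, Rho i], pos_word [Rho j, Rho i, Rho j]) | i j.
        1 \<le> i \<and> i \<le> n - 1 \<and> 1 \<le> j \<and> j \<le> n - 1 \<and> \<bar>int i - int j\<bar> = 1}
   \<union> {(pos_word [Rho i, Rho j], pos_word [Rho j, Rho i]) | i j.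
        1 \<le> i \<and> i \<le> n - 1 \<and> 1 \<le> j \<and> j \<le> n - 1 \<and> \<bar>int i - int j\<bar> > 1}
   \<union> {(pos_word [Rho i, X p q], pos_word [X p q, Rho i]) | i p q.
        1 \<le> i \<and> i \<le> n - 1 \<and> 1 \<le> p \<and> p < q \<and> q \<le> n \<and> (i < p - 1 \<or> i \<ge> q + 1)}
   \<union> {(pos_word (X p q # map Rho (rev [p..<q + 1])),
       pos_word (map Rho (rev [p..<q + 1]) @ [X (p + 1) (q + 1)])) | p q.
        1 \<le> p \<and> p < q \<and> q < n}"

definition VJ :: "nat \<Rightarrow> vj_letter word set monoid" where
  "VJ n = presented_group (vj_letters n) (vj_rels n)"

definition vj_gen :: "nat \<Rightarrow> vj_letter \<Rightarrow> vj_letter word set" where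
  "vj_gen n = pres_gen (vj_letters n) (vj_rels n)"

definition iota_S :: "nat \<Rightarrow> (nat \<Rightarrow> nat) \<Rightarrow> vj_letter word set" where
  "iota_S n = the_hom (sym_group n) (VJ n) {1..n - 1}
    (\<lambda>i. transpose i (i + 1)) (\<lambda>i. vj_gen n (Rho i))"

fun pi_K_letter :: "vj_letter \<Rightarrow> nat \<Rightarrow> nat" where
  "pi_K_letter (X p q) = id"
| "pi_K_letter (Rho i) = transpose i (i + 1)"

definition pi_K :: "nat \<Rightarrow> vj_letter word set \<Rightarrow> nat \<Rightarrow> nat" where
  "pi_K n = the_hom (VJ n) (sym_group n) (vj_letters n) (vj_gen n) pi_K_letter"

definition KVJ :: "nat \<Rightarrow> vj_letter word set monoid" where
  "KVJ n = (VJ n)\<lparr>carrier := kernel (VJ n) (sym_group n) (pi_K n)\<rparr>"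

section \<open>The trickle graph of the pure virtual cactus group\<close>

definition tuples :: "nat \<Rightarrow> nat list set" where
  "tuples n = {t. 2 \<le> length t \<and> length t \<le> n \<and> set t \<subseteq> {1..n} \<and> distinct t}"

text \<open>\<open>segment t p q\<close> is \<open>(t\<^sub>p, \<dots>, t\<^sub>q)\<close>, with 1-based indices as opposed to \<open>(!)\<close>.\<close>

definition segment :: "'a list \<Rightarrow> nat \<Rightarrow> nat \<Rightarrow> 'a list" where
  "segment t p q = map (\<lambda>i. t ! (i - 1)) [p..<q + 1]"

definition tuple_le :: "nat list \<Rightarrow> nat list \<Rightarrow> bool" where
  "tuple_le y' y \<longleftrightarrow> (\<exists>p q. 1 \<le> p \<and> p < q \<and> q \<le> length y \<and> y' = segment y p q)"

definition tuple_aut :: "nat list \<Rightarrow> nat list \<Rightarrow> nat list" where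
  "tuple_aut y y' =
    (if tuple_le y' y
     then THE z. \<exists>p q. 1 \<le> p \<and> p < q \<and> q \<le> length y \<and> y' = segment y p q \<and>
            z = segment y (1 + length y - q) (1 + length y - p)
     else y')"

definition Gam :: "nat \<Rightarrow> nat list trickle_data" where
  "Gam n = \<lparr> verts = tuples n,
     edges = {{y, y'} | y y'. y \<in> tuples n \<and> y' \<in> tuples n \<and> y \<noteq> y' \<and>
               (tuple_le y y' \<or> tuple_le y' y \<or> set y \<inter> set y' = {})},
     ordr = {(y', y). y' \<in> tuples n \<and> y \<in> tuples n \<and> tuple_le y' y},
     label = (\<lambda>y. 2),
     aut = tuple_aut \<rparr>"

text \<open>The value does not depend on the choice of \<open>w\<close>.  Products in \<open>sym_group n\<close> are compositions
  of functions, \<open>(v w)(i) = v(w(i))\<close>.\<close>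

definition delta :: "nat \<Rightarrow> nat list \<Rightarrow> vj_letter word set" where
  "delta n y =
    (let w = SOME w. w \<in> carrier (sym_group n) \<and> (\<forall>i\<in>{1..length y}. w i = y ! (i - 1))
     in iota_S n w \<otimes>\<^bsub>VJ n\<^esub> vj_gen n (X 1 (length y)) \<otimes>\<^bsub>VJ n\<^esub> inv\<^bsub>VJ n\<^esub> (iota_S n w))"

definition Phi :: "nat \<Rightarrow> nat list word set \<Rightarrow> vj_letter word set" where
  "Phi n = the_hom (trickle_group (Gam n)) (KVJ n) (tuples n) (trickle_gen (Gam n)) (delta n)"

section \<open>\<open>Gam n\<close> is a trickle graph\<close>

lemma segment_simps [simp]:
  "length (segment t p q) = q + 1 - p"
  "i < q + 1 - p \<Longrightarrow> segment t p q ! i = t ! (p + i - 1)"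
  by (simp_all add: segment_def del: upt_Suc)

lemma segment_full: "segment t 1 (length t) = t"
  by (rule nth_equalityI) simp_all

lemma segment_segment:
  assumes "1 \<le> p" "1 \<le> a" "a < b" "b \<le> q + 1 - p"
  shows "segment (segment t p q) a b = segment t (p + a - 1) (p + b - 1)"
  using assms by (intro nth_equalityI) (auto simp: algebra_simps)

lemma set_segment: "set (segment t p q) = (\<lambda>i. t ! (i - 1)) ` {p..q}"
  by (auto simp: segment_def)

lemma nth_pred_inj:
  assumes "distinct t"
  shows "inj_on (\<lambda>i. t ! (i - 1)) {1..length t}"
proof (rule inj_onI)
  fix i j assume "i \<in> {1..length t}" "j \<in> {1..length t}" "t ! (i - 1) = t ! (j - 1)"
  then have "i - 1 = j - 1" using nth_eq_iff_index_eq[OF assms, of "i - 1" "j - 1"] by auto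
  then show "i = j" using \<open>i \<in> _\<close> \<open>j \<in> _\<close> by auto
qed

lemma set_segment_subset_iff:
  assumes "distinct t" "1 \<le> p" "p < q" "q \<le> length t" "1 \<le> a" "a < b" "b \<le> length t"
  shows "set (segment t a b) \<subseteq> set (segment t p q) \<longleftrightarrow> p \<le> a \<and> b \<le> q"
proof -
  have mem: "t ! (i - 1) \<in> (\<lambda>i. t ! (i - 1)) ` {p..q} \<longleftrightarrow> i \<in> {p..q}" if "i \<in> {a..b}" for i
    using assms that by (intro inj_on_image_mem_iff[OF nth_pred_inj[OF assms(1)]]) auto
  have "(\<lambda>i. t ! (i - 1)) ` {a..b} \<subseteq> (\<lambda>i. t ! (i - 1)) ` {p..q} \<longleftrightarrow> {a..b} \<subseteq> {p..q}"
    using mem by (simp add: image_subset_iff subset_eq)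
  then show ?thesis unfolding set_segment using assms by auto
qed

lemma set_segment_disjoint_iff:
  assumes "distinct t" "1 \<le> p" "p < q" "q \<le> length t" "1 \<le> a" "a < b" "b \<le> length t"
  shows "set (segment t a b) \<inter> set (segment t p q) = {} \<longleftrightarrow> b < p \<or> q < a"
proof -
  have "(\<lambda>i. t ! (i - 1)) ` {a..b} \<inter> (\<lambda>i. t ! (i - 1)) ` {p..q} =
      (\<lambda>i. t ! (i - 1)) ` ({a..b} \<inter> {p..q})"
    using assms by (intro inj_on_image_Int[OF nth_pred_inj[OF assms(1)], symmetric]) auto
  then show ?thesis unfolding set_segment using assms by auto
qed

lemma segment_eq_iff:
  assumes "distinct t" "1 \<le> p" "p < q" "q \<le> length t" "1 \<le> a" "a < b" "b \<le> length t"
  shows "segment t a b = segment t p q \<longleftrightarrow> a = p \<and> b = q"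
  using set_segment_subset_iff[OF assms] set_segment_subset_iff[of t a b p q] assms
  by (metis order.antisym subset_refl)

lemma segment_le_iff:
  assumes "distinct t" "1 \<le> p" "p < q" "q \<le> length t" "1 \<le> a" "a < b" "b \<le> length t"
  shows "tuple_le (segment t a b) (segment t p q) \<longleftrightarrow> p \<le> a \<and> b \<le> q"
proof
  assume "tuple_le (segment t a b) (segment t p q)"
  then obtain c d where "1 \<le> c" "c < d" "d \<le> q + 1 - p"
    "segment t a b = segment t (p + c - 1) (p + d - 1)"
    using assms by (auto simp: tuple_le_def segment_segment)
  moreover from this have "a = p + c - 1 \<and> b = p + d - 1"
    using assms by (subst segment_eq_iff[symmetric, of t]) auto
  ultimately show "p \<le> a \<and> b \<le> q" using assms by auto
next
  assume *: "p \<le> a \<and> b \<le> q"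
  have "segment t a b = segment (segment t p q) (a + 1 - p) (b + 1 - p)"
    using assms * by (subst segment_segment) auto
  then show "tuple_le (segment t a b) (segment t p q)"
    unfolding tuple_le_def using assms *
    by (intro exI[of _ "a + 1 - p"] exI[of _ "b + 1 - p"]) auto
qed

lemma tuple_leE:
  assumes "tuple_le y x"
  obtains p q where "1 \<le> p" "p < q" "q \<le> length x" "y = segment x p q"
  using assms by (auto simp: tuple_le_def)

lemma tuple_le_segment:
  "1 \<le> p \<Longrightarrow> p < q \<Longrightarrow> q \<le> length x \<Longrightarrow> tuple_le (segment x p q) x"
  by (auto simp: tuple_le_def)

lemma tuple_le_set: "tuple_le y x \<Longrightarrow> set y \<subseteq> set x"
  by (auto simp: tuple_le_def set_segment)

lemma tuple_le_length: "tuple_le y x \<Longrightarrow> 2 \<le> length y \<and> length y \<le> length x"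
  by (auto simp: tuple_le_def)

lemma tuple_le_refl: "2 \<le> length x \<Longrightarrow> tuple_le x x"
  using tuple_le_segment[of 1 "length x" x] segment_full[of x] by simp

lemma tuple_le_trans:
  assumes "tuple_le z y" "tuple_le y x" shows "tuple_le z x"
proof -
  obtain p q a b where "1 \<le> p" "p < q" "q \<le> length x" "y = segment x p q"
    "1 \<le> a" "a < b" "b \<le> length y" "z = segment y a b"
    using assms by (auto simp: tuple_le_def)
  then show ?thesis by (auto simp: segment_segment intro!: tuple_le_segment)
qed

lemma tuple_le_antisym:
  assumes "tuple_le y x" "tuple_le x y" shows "x = y"
proof -
  obtain p q where pq: "1 \<le> p" "p < q" "q \<le> length x" "y = segment x p q"
    using assms(1) by (rule tuple_leE)
  have "length x = length y"
    using assms by (meson tuple_le_length order.antisym)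
  then have "p = 1" "q = length x" using pq by auto
  then show ?thesis using pq(4) by (simp only: segment_full)
qed

lemma tuple_le_tuples:
  assumes "tuple_le y x" "x \<in> tuples n" shows "y \<in> tuples n"
proof -
  obtain p q where pq: "1 \<le> p" "p < q" "q \<le> length x" "y = segment x p q"
    using assms(1) by (rule tuple_leE)
  have "distinct x" using assms(2) by (simp add: tuples_def)
  then have "inj_on (\<lambda>i. x ! (i - 1)) (set [p..<q + 1])"
    using pq by (intro inj_on_subset[OF nth_pred_inj]) auto
  then have "distinct y" unfolding pq(4) segment_def distinct_map by simp
  then show ?thesis
    using tuple_le_set[OF assms(1)] tuple_le_length[OF assms(1)] assms(2)
    by (auto simp: tuples_def)
qed

lemma tuple_aut_segment:
  assumes "distinct x" "1 \<le> p" "p < q" "q \<le> length x"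
  shows "tuple_aut x (segment x p q) = segment x (1 + length x - q) (1 + length x - p)"
proof -
  have "(THE z. \<exists>p' q'. 1 \<le> p' \<and> p' < q' \<and> q' \<le> length x \<and> segment x p q = segment x p' q' \<and>
            z = segment x (1 + length x - q') (1 + length x - p')) =
        segment x (1 + length x - q) (1 + length x - p)"
    using assms by (intro the_equality) (use segment_eq_iff[OF assms(1)] in blast)+
  then show ?thesis
    using tuple_le_segment[OF assms(2-4)] by (simp add: tuple_aut_def)
qed

lemma tuple_aut_other: "\<not> tuple_le y x \<Longrightarrow> tuple_aut x y = y"
  by (simp add: tuple_aut_def)

lemma tuple_aut_le:
  assumes "distinct x" "tuple_le y x" shows "tuple_le (tuple_aut x y) x"
proof -
  obtain p q where pq: "1 \<le> p" "p < q" "q \<le> length x" "y = segment x p q"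
    using assms(2) by (rule tuple_leE)
  then show ?thesis using assms(1) by (auto simp: tuple_aut_segment intro!: tuple_le_segment)
qed

lemma tuple_aut_tuple_aut:
  assumes "distinct x" shows "tuple_aut x (tuple_aut x y) = y"
proof (cases "tuple_le y x")
  case True
  then obtain p q where "1 \<le> p" "p < q" "q \<le> length x" "y = segment x p q"
    by (rule tuple_leE)
  then show ?thesis using assms by (simp add: tuple_aut_segment)
qed (simp add: tuple_aut_other)

lemma tuple_aut_self:
  assumes "distinct x" "2 \<le> length x" shows "tuple_aut x x = x"
  using tuple_aut_segment[of x 1 "length x"] assms segment_full[of x] by simp

lemma Gam_simps [simp]:
  "verts (Gam n) = tuples n"
  "(y', y) \<in> ordr (Gam n) \<longleftrightarrow> y' \<in> tuples n \<and> y \<in> tuples n \<and> tuple_le y' y"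
  "label (Gam n) y = 2"
  "aut (Gam n) = tuple_aut"
  by (simp_all add: Gam_def)

lemma Gam_edges:
  "{y, y'} \<in> edges (Gam n) \<longleftrightarrow> y \<in> tuples n \<and> y' \<in> tuples n \<and> y \<noteq> y' \<and>
     (tuple_le y y' \<or> tuple_le y' y \<or> set y \<inter> set y' = {})"
  by (auto simp: Gam_def doubleton_eq_iff)

lemma Gam_star:
  assumes "x \<in> tuples n"
  shows "star (Gam n) x =
    {y \<in> tuples n. tuple_le x y \<or> tuple_le y x \<or> set x \<inter> set y = {}}"
  using assms tuple_le_refl[of x] by (auto simp: star_def Gam_edges tuples_def)

lemma tuple_aut_set:
  assumes "distinct x" "tuple_le y x" shows "set (tuple_aut x y) \<subseteq> set x"
  using tuple_le_set[OF tuple_aut_le[OF assms]] .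

lemma tuple_aut_star:
  assumes "x \<in> tuples n" "y \<in> star (Gam n) x"
  shows "tuple_aut x y \<in> star (Gam n) x"
proof (cases "tuple_le y x")
  case True
  then have "tuple_le (tuple_aut x y) x" using assms tuple_aut_le by (auto simp: tuples_def)
  then show ?thesis using assms tuple_le_tuples by (auto simp: Gam_star)
qed (use assms in \<open>simp add: tuple_aut_other\<close>)

lemma tuple_aut_le_mono:
  assumes x: "x \<in> tuples n" and y: "y \<in> star (Gam n) x" and z: "z \<in> star (Gam n) x"
    and le: "tuple_le z y"
  shows "tuple_le (tuple_aut x z) (tuple_aut x y)"
proof -
  have d: "distinct x" and x2: "2 \<le> length x" using x by (auto simp: tuples_def)
  consider "tuple_le y x" | "\<not> tuple_le y x" "tuple_le z x" | "\<not> tuple_le z x"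
    "\<not> tuple_le y x" using le tuple_le_trans by blast
  then show ?thesis
  proof cases
    case 1
    obtain p q where pq: "1 \<le> p" "p < q" "q \<le> length x" "y = segment x p q"
      using 1 by (rule tuple_leE)
    obtain a b where ab: "1 \<le> a" "a < b" "b \<le> length x" "z = segment x a b"
      using tuple_le_trans[OF le 1] by (rule tuple_leE)
    have "p \<le> a \<and> b \<le> q" using le pq ab segment_le_iff[of x p q a b] d by auto
    then show ?thesis using pq ab d by (auto simp: tuple_aut_segment segment_le_iff)
  next
    case 2
    have "set z \<noteq> {}" using tuple_le_length[OF le] by auto
    then have "set x \<inter> set y \<noteq> {}"
      using tuple_le_set[OF le] tuple_le_set[OF 2(2)] by (metis Int_greatest subset_empty)
    then have "tuple_le x y" using y 2 x by (auto simp: Gam_star)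
    then show ?thesis
      using tuple_aut_le[OF d 2(2)] 2(1) by (auto simp: tuple_aut_other intro: tuple_le_trans)
  next
    case 3
    then show ?thesis using le by (simp add: tuple_aut_other)
  qed
qed

lemma tuple_aut_disjoint:
  assumes x: "x \<in> tuples n" and y: "y \<in> star (Gam n) x" and z: "z \<in> star (Gam n) x"
    and dis: "set y \<inter> set z = {}"
  shows "set (tuple_aut x y) \<inter> set (tuple_aut x z) = {}"
proof -
  have d: "distinct x" using x by (auto simp: tuples_def)
  have mixed: "set (tuple_aut x u) \<inter> set v = {}"
    if "tuple_le u x" "v \<in> star (Gam n) x" "\<not> tuple_le v x" "set u \<inter> set v = {}" for u v
  proof -
    have "set u \<noteq> {}" using tuple_le_length[OF that(1)] by auto
    moreover have "set u \<subseteq> set v" if "tuple_le x v"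
      using tuple_le_set[OF that] tuple_le_set[OF \<open>tuple_le u x\<close>] by (rule order.trans[rotated])
    ultimately have "\<not> tuple_le x v" using \<open>set u \<inter> set v = {}\<close> by (auto simp: Int_absorb2)
    then have "set x \<inter> set v = {}" using that x by (auto simp: Gam_star)
    then show ?thesis using tuple_aut_set[OF d that(1)] by blast
  qed
  consider "tuple_le y x" "tuple_le z x" | "tuple_le y x" "\<not> tuple_le z x"
    | "\<not> tuple_le y x" "tuple_le z x" | "\<not> tuple_le y x" "\<not> tuple_le z x" by blast
  then show ?thesis
  proof cases
    case 1
    obtain p q where pq: "1 \<le> p" "p < q" "q \<le> length x" "y = segment x p q"
      using 1(1) by (rule tuple_leE)
    obtain a b where ab: "1 \<le> a" "a < b" "b \<le> length x" "z = segment x a b"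
      using 1(2) by (rule tuple_leE)
    have "q < a \<or> b < p" using dis pq ab set_segment_disjoint_iff[of x a b p q] d by auto
    then show ?thesis using pq ab d
      by (auto simp: tuple_aut_segment set_segment_disjoint_iff)
  next
    case 2 then show ?thesis using mixed[of y z] z dis by (simp add: tuple_aut_other)
  next
    case 3 then show ?thesis using mixed[of z y] y dis by (auto simp: tuple_aut_other)
  next
    case 4 then show ?thesis using dis by (simp add: tuple_aut_other)
  qed
qed

theorem trickle_graph_Gam: "trickle_graph (Gam n)"
proof
  fix e assume "e \<in> edges (Gam n)"
  then show "\<exists>x\<in>verts (Gam n). \<exists>y\<in>verts (Gam n). x \<noteq> y \<and> e = {x, y}"
    by (auto simp: Gam_def)
next
  show "partial_order_on (verts (Gam n)) (ordr (Gam n))"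
    unfolding partial_order_on_def preorder_on_def refl_on_def trans_def antisym_def
    using tuple_le_refl tuple_le_trans tuple_le_antisym
    by (intro conjI ballI allI impI subrelI) (auto simp: tuples_def, blast?)
next
  fix x show "2 \<le> label (Gam n) x" by simp
next
  fix x assume x: "x \<in> verts (Gam n)"
  then have d: "distinct x" by (auto simp: tuples_def)
  have star: "\<And>y. y \<in> star (Gam n) x \<Longrightarrow> tuple_aut x y \<in> star (Gam n) x"
    using x tuple_aut_star by simp
  show bij: "bij_betw (aut (Gam n) x) (star (Gam n) x) (star (Gam n) x)"
    by (rule bij_betw_byWitness[where f' = "tuple_aut x"])
      (auto simp: tuple_aut_tuple_aut[OF d] star)
  {
    fix y z assume yz: "y \<in> star (Gam n) x" "z \<in> star (Gam n) x"
    have mono: "tuple_le (tuple_aut x u) (tuple_aut x v) \<longleftrightarrow> tuple_le u v"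
      if "u \<in> star (Gam n) x" "v \<in> star (Gam n) x" for u v
      using tuple_aut_le_mono[of x n v u] tuple_aut_le_mono[of x n "tuple_aut x v" "tuple_aut x u"]
        that x star by (auto simp: tuple_aut_tuple_aut[OF d])
    have dis: "set (tuple_aut x y) \<inter> set (tuple_aut x z) = {} \<longleftrightarrow> set y \<inter> set z = {}"
      using tuple_aut_disjoint[of x n y z]
        tuple_aut_disjoint[of x n "tuple_aut x y" "tuple_aut x z"]
        yz x star by (auto simp: tuple_aut_tuple_aut[OF d])
    have inj: "tuple_aut x y = tuple_aut x z \<longleftrightarrow> y = z"
      by (metis tuple_aut_tuple_aut[OF d])
    have V: "y \<in> tuples n" "z \<in> tuples n" "tuple_aut x y \<in> tuples n" "tuple_aut x z \<in> tuples n"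
      using yz star x by (auto simp: Gam_star)
    show "{aut (Gam n) x y, aut (Gam n) x z} \<in> edges (Gam n) \<longleftrightarrow> {y, z} \<in> edges (Gam n)"
      using V yz by (simp add: Gam_edges mono dis inj)
    show "(z, y) \<in> ordr (Gam n) \<longleftrightarrow> (aut (Gam n) x z, aut (Gam n) x y) \<in> ordr (Gam n)"
      using V yz by (simp add: mono)
  }
  fix y assume y: "y \<in> star (Gam n) x"
  show "label (Gam n) (aut (Gam n) x y) = label (Gam n) y" by simp
  show "(y, x) \<in> ordr (Gam n) \<and> y \<noteq> x" if "aut (Gam n) x y \<noteq> y"
    using that y x tuple_aut_other[of y x] tuple_aut_self[of x]
    by (auto simp: Gam_star tuples_def)
next
  fix x m assume x: "x \<in> verts (Gam n)" and m: "label (Gam n) x = enat m"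
  let ?S = "star (Gam n) x" and ?f = "restrict (aut (Gam n) x) (star (Gam n) x)"
  have d: "distinct x" using x by (auto simp: tuples_def)
  have m2: "m = 2" using m by (simp add: numeral_eq_enat)
  interpret group "BijGroup ?S" by (rule group_BijGroup)
  have star: "\<And>y. y \<in> ?S \<Longrightarrow> tuple_aut x y \<in> ?S" using x tuple_aut_star by simp
  have "bij_betw (tuple_aut x) ?S ?S"
    by (rule bij_betw_byWitness[where f' = "tuple_aut x"])
      (auto simp: tuple_aut_tuple_aut[OF d] star)
  then have f: "?f \<in> carrier (BijGroup ?S)" by (simp add: BijGroup_def Bij_def)
  have "compose ?S ?f ?f = (\<lambda>y\<in>?S. y)"
    by (rule ext) (auto simp: compose_def star tuple_aut_tuple_aut[OF d])
  then have "?f \<otimes>\<^bsub>BijGroup ?S\<^esub> ?f = \<one>\<^bsub>BijGroup ?S\<^esub>"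
    using f by (simp add: BijGroup_def)
  then have "?f [^]\<^bsub>BijGroup ?S\<^esub> (2::nat) = \<one>\<^bsub>BijGroup ?S\<^esub>"
    using f by (simp add: numeral_2_eq_2)
  then show "ord ?f dvd m" using f m2 by (simp add: pow_eq_id)
next
  fix x y assume "(x, y) \<in> ordr (Gam n)" "x \<noteq> y"
  then show "{x, y} \<in> edges (Gam n)" by (simp add: Gam_edges)
next
  fix x y z assume "{x, y} \<in> par_edges (Gam n)" and zy: "(z, y) \<in> ordr (Gam n)"
  then have V: "x \<in> tuples n" "y \<in> tuples n" "z \<in> tuples n" "tuple_le z y"
    and "set x \<inter> set y = {}"
    by (auto simp: par_edges_def doubleton_eq_iff Gam_edges)
  then have dis: "set x \<inter> set z = {}" using tuple_le_set[of z y] by blast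
  have "set x \<noteq> {}" "set z \<noteq> {}" using V by (auto simp: tuples_def)
  then have "\<not> tuple_le x z" "\<not> tuple_le z x" "x \<noteq> z"
    using dis by (auto dest: tuple_le_set simp: Int_absorb1 Int_absorb2)
  then show "{x, z} \<in> par_edges (Gam n)"
    using V dis unfolding par_edges_def
    by (intro CollectI exI[of _ x] exI[of _ z]) (simp add: Gam_edges)
next
  fix x y z assume zy: "(z, y) \<in> ordr (Gam n)" and yx: "(y, x) \<in> ordr (Gam n)"
  have d: "distinct x" using yx by (auto simp: tuples_def)
  obtain p q where pq: "1 \<le> p" "p < q" "q \<le> length x" "y = segment x p q"
    using yx by (auto elim: tuple_leE)
  obtain a b where ab: "1 \<le> a" "a < b" "b \<le> length y" "z = segment y a b"
    using zy by (auto elim: tuple_leE)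
  let ?l = "length x"
  have dy: "distinct y" using zy by (auto simp: tuples_def)
  have ly: "length y = q + 1 - p" by (simp add: pq)
  obtain d where d': "q = p + d" using pq(2) less_imp_add_positive by blast
  obtain e where e: "?l = p + d + e" using pq(3) d' by (auto simp: le_iff_add)
  obtain c where c: "b = a + c" "0 < c" using ab(2) less_imp_add_positive by blast
  obtain h where h: "d + 1 = a + c + h"
    using ab(3) c ly d' by (metis le_iff_add diff_add_inverse add.assoc)
  obtain i where i: "a = Suc i" using ab(1) by (cases a) auto
  have h': "d = i + c + h" using h i by simp
  note eqs = ly d' e c(1) h' i
  have y': "tuple_aut x y = segment x (1 + ?l - q) (1 + ?l - p)"
    using tuple_aut_segment[OF d pq(1-3)] pq(4) by simp
  have "tuple_aut x y \<in> tuples n"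
    using yx tuple_aut_le[OF d, of y] tuple_le_tuples by auto
  then have dy': "distinct (tuple_aut x y)" by (simp add: tuples_def)
  have ly': "length (tuple_aut x y) = q + 1 - p" unfolding y' using pq(1-3) by simp
  have z: "z = segment x (p + a - 1) (p + b - 1)"
    using ab pq by (simp add: segment_segment)
  have "tuple_aut y z = segment y (1 + length y - b) (1 + length y - a)"
    using tuple_aut_segment[OF dy ab(1-3)] ab(4) by simp
  also have "\<dots> = segment x (q + 1 - b) (q + 1 - a)"
  proof -
    have "1 \<le> 1 + length y - b" "1 + length y - b < 1 + length y - a"
      "1 + length y - a \<le> q + 1 - p" "p + (1 + length y - b) - 1 = q + 1 - b"
      "p + (1 + length y - a) - 1 = q + 1 - a"
      using pq(1) c(2) by (simp_all add: eqs)
    then show ?thesis using segment_segment[OF pq(1)] pq(4) by metis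
  qed
  finally have yz: "tuple_aut y z = segment x (q + 1 - b) (q + 1 - a)" .
  have "1 \<le> q + 1 - b" "q + 1 - b < q + 1 - a" "q + 1 - a \<le> ?l"
    "1 + ?l - (q + 1 - a) = ?l + a - q" "1 + ?l - (q + 1 - b) = ?l + b - q"
    using pq(1) c(2) by (simp_all add: eqs)
  then have "tuple_aut x (tuple_aut y z) = segment x (?l + a - q) (?l + b - q)"
    unfolding yz by (subst tuple_aut_segment[OF d]) auto
  moreover have "tuple_aut x z = segment x (2 + ?l - p - b) (2 + ?l - p - a)"
  proof -
    have "1 \<le> p + a - 1" "p + a - 1 < p + b - 1" "p + b - 1 \<le> ?l"
      "1 + ?l - (p + b - 1) = 2 + ?l - p - b" "1 + ?l - (p + a - 1) = 2 + ?l - p - a"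
      using pq(1) c(2) by (simp_all add: eqs)
    then show ?thesis unfolding z by (subst tuple_aut_segment[OF d]) auto
  qed
  moreover have "\<dots> = segment (tuple_aut x y) (q + 2 - p - b) (q + 2 - p - a)"
  proof -
    have "q + 2 - p - b \<ge> 1" "q + 2 - p - b < q + 2 - p - a" "q + 2 - p - a \<le> q + 1 - p"
      "1 + ?l - q + (q + 2 - p - b) - 1 = 2 + ?l - p - b"
      "1 + ?l - q + (q + 2 - p - a) - 1 = 2 + ?l - p - a"
      using pq(1) c(2) by (simp_all add: eqs)
    then show ?thesis using pq unfolding y' by (subst segment_segment) auto
  qed
  moreover have "tuple_aut (tuple_aut x y) (segment (tuple_aut x y) (q + 2 - p - b) (q + 2 - p - a))
      = segment (tuple_aut x y) a b"
    using ab pq ly ly' by (subst tuple_aut_segment[OF dy']) auto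
  moreover have "segment (tuple_aut x y) a b = segment x (?l + a - q) (?l + b - q)"
  proof -
    have "1 \<le> 1 + ?l - q" "b \<le> 1 + ?l - p + 1 - (1 + ?l - q)"
      "1 + ?l - q + a - 1 = ?l + a - q" "1 + ?l - q + b - 1 = ?l + b - q"
      using pq(1) c(2) by (simp_all add: eqs)
    then show ?thesis using ab unfolding y' by (subst segment_segment) auto
  qed
  ultimately show "aut (Gam n) x (aut (Gam n) y z) = aut (Gam n) (aut (Gam n) x y) (aut (Gam n) x z)"
    by simp
qed

end

theory Submission
  imports Defs
begin

text \<open>The reason is that \<open>\<pi>\<^sub>K\<close> is a split surjection, with splitting \<open>\<iota>\<^sub>S\<close>, so the virtual cactus
  group is the semidirect product of its kernel with the symmetric group; it therefore suffices to
  recognise it as the semidirect product of \<open>Tr(\<Gamma>)\<close> with the symmetric group, where a permutation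
  \<open>w\<close> acts on \<open>Tr(\<Gamma>)\<close> by \<open>(t\<^sub>1, \<dots>, t\<^sub>l) \<mapsto> (w(t\<^sub>1), \<dots>, w(t\<^sub>l))\<close> on the vertices.  Two homomorphisms
  do this.

  \<^item> \<open>\<Psi>\<close> goes from the virtual cactus group to the semidirect product.  It sends \<open>x\<^sub>p\<^sub>,\<^sub>q\<close> to the vertex
    \<open>(p, p + 1, \<dots>, q)\<close> and \<open>\<rho>\<^sub>i\<close> to \<open>s\<^sub>i\<close>.  The cactus relations between the \<open>x\<^sub>p\<^sub>,\<^sub>q\<close> become trickle
    relations between intervals, and the mixed relations become equations between translates of
    intervals (\<open>vj_to_semidirect_exists\<close>).
  \<^item> \<open>\<Theta>\<close> goes back and sends \<open>(a, w)\<close> to \<open>\<phi>(a) \<iota>\<^sub>S(w)\<close>, where \<open>\<phi>\<close> is the homomorphism with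
    \<open>\<phi>(y) = \<delta>\<^sub>y\<close>.  It is a homomorphism because \<open>\<iota>\<^sub>S(w) \<delta>\<^sub>y \<iota>\<^sub>S(w)\<^sup>-\<^sup>1 = \<delta>\<^sub>w\<^sub>y\<close> (\<open>conj_by_delta\<close>).

  On generators one reads off \<open>\<Theta>(\<Psi>(g)) = g\<close> and \<open>\<Psi>(\<phi>(a)) = (a, 1)\<close>, and \<open>\<pi>\<^sub>K\<close> is the second component
  of \<open>\<Psi>\<close>.  The second identity makes \<open>\<phi>\<close> injective.  If \<open>\<pi>\<^sub>K(g) = 1\<close>, then \<open>\<Psi>(g) = (a, 1)\<close> for some
  \<open>a\<close>, and the first identity gives \<open>g = \<phi>(a)\<close>; so \<open>\<phi>\<close> maps onto the kernel.

  Two facts carry the construction.  That \<open>\<iota>\<^sub>S\<close> exists at all is the Coxeter presentation of the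
  symmetric group (\<open>coxeter_hom_exists\<close>).  That the \<open>\<delta>\<^sub>y\<close> satisfy the trickle relations follows from
  \<open>\<delta>\<^bsub>(p,\<dots>,q)\<^esub> = x\<^sub>p\<^sub>,\<^sub>q\<close> (\<open>delta_interval\<close>): a tuple together with its segments, or two disjoint
  tuples, are moved simultaneously to intervals by one permutation, and there the trickle relations
  are cactus relations.\<close>

section \<open>Homomorphisms out of a presented group\<close>

definition word_value :: "('b, 'm) monoid_scheme \<Rightarrow> ('a \<Rightarrow> 'b) \<Rightarrow> 'a word \<Rightarrow> 'b" where
  "word_value H f u = foldr (\<lambda>(a, b) g. (if b then f a else inv\<^bsub>H\<^esub> f a) \<otimes>\<^bsub>H\<^esub> g) u \<one>\<^bsub>H\<^esub>"

lemma words_simps [simp]: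
  "[] \<in> words L"
  "(a, b) # u \<in> words L \<longleftrightarrow> a \<in> L \<and> u \<in> words L"
  "u @ v \<in> words L \<longleftrightarrow> u \<in> words L \<and> v \<in> words L"
  by (auto simp: words_def)

lemma pos_word_in_words [simp]: "pos_word as \<in> words L \<longleftrightarrow> set as \<subseteq> L"
  by (induction as) (auto simp: pos_word_def)

lemma word_value_simps [simp]:
  "word_value H f [] = \<one>\<^bsub>H\<^esub>"
  "word_value H f ((a, b) # u) = (if b then f a else inv\<^bsub>H\<^esub> f a) \<otimes>\<^bsub>H\<^esub> word_value H f u"
  by (simp_all add: word_value_def)

lemma word_value_pos_word [simp]:
  "word_value H f (pos_word []) = \<one>\<^bsub>H\<^esub>"
  "word_value H f (pos_word (a # as)) = f a \<otimes>\<^bsub>H\<^esub> word_value H f (pos_word as)"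
  by (simp_all add: pos_word_def)

context group
begin

lemma word_value_closed:
  assumes "f \<in> L \<rightarrow> carrier G" "u \<in> words L"
  shows "word_value G f u \<in> carrier G"
  using assms(2) by (induction u) (use assms(1) in \<open>auto simp: Pi_iff\<close>)

lemma word_value_append:
  assumes f: "f \<in> L \<rightarrow> carrier G" and "u \<in> words L" "v \<in> words L"
  shows "word_value G f (u @ v) = word_value G f u \<otimes> word_value G f v"
  using assms(2)
proof (induction u)
  case (Cons l u)
  obtain a b where l: "l = (a, b)" by (cases l)
  have "(if b then f a else inv f a) \<in> carrier G" using f Cons.prems l by auto
  then show ?case
    using Cons word_value_closed[OF f] assms(3) by (simp add: l m_assoc)
qed (use assms word_value_closed[OF f] in simp)

lemma word_value_respects:
  assumes f: "f \<in> L \<rightarrow> carrier G"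
    and rels: "\<And>u v. (u, v) \<in> R \<Longrightarrow> u \<in> words L \<Longrightarrow> v \<in> words L \<Longrightarrow>
      word_value G f u = word_value G f v"
    and "word_eq L R u v"
  shows "word_value G f u = word_value G f v"
  using assms(3)
proof (induction rule: word_eq.induct)
  case (append u v u' v')
  then show ?case
    using word_eq_in_words[OF append.hyps(1)] word_eq_in_words[OF append.hyps(2)]
    by (simp add: word_value_append[OF f])
next
  case (cancel a b)
  then have "f a \<in> carrier G" using f by auto
  then show ?case by (cases b) simp_all
next
  case (relation u v)
  then show ?case by (rule rels)
qed simp_all

text \<open>Evaluation of any representative word gives the homomorphism; the relations make the value
  independent of the representative.\<close>

lemma presented_group_hom_exists:
  assumes f: "f \<in> L \<rightarrow> carrier G"
    and rels: "\<And>u v. (u, v) \<in> R \<Longrightarrow> u \<in> words L \<Longrightarrow> v \<in> words L \<Longrightarrow>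
      word_value G f u = word_value G f v"
  shows "\<exists>h\<in>hom (presented_group L R) G. \<forall>a\<in>L. h (pres_gen L R a) = f a"
proof
  define h where "h A = word_value G f (SOME u. u \<in> A)" for A
  have h: "h (word_class L R u) = word_value G f u" if "u \<in> words L" for u
  proof -
    have "(SOME v. v \<in> word_class L R u) \<in> word_class L R u"
      by (rule someI[of "\<lambda>v. v \<in> word_class L R u" u])
        (use that in \<open>simp add: word_class_def word_eq.refl\<close>)
    then have "word_eq L R u (SOME v. v \<in> word_class L R u)" by (simp add: word_class_def)
    then have "word_value G f u = word_value G f (SOME v. v \<in> word_class L R u)"
      by (rule word_value_respects[OF f, rotated]) (rule rels)
    then show ?thesis by (simp add: h_def)
  qed
  show "h \<in> hom (presented_group L R) G"
  proof (rule homI)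
    fix A assume "A \<in> carrier (presented_group L R)"
    then obtain u where u: "u \<in> words L" "A = word_class L R u"
      by (auto simp: presented_group_def)
    then show "h A \<in> carrier G" using h word_value_closed[OF f] by simp
    fix B assume "B \<in> carrier (presented_group L R)"
    then obtain v where v: "v \<in> words L" "B = word_class L R v"
      by (auto simp: presented_group_def)
    show "h (A \<otimes>\<^bsub>presented_group L R\<^esub> B) = h A \<otimes> h B"
      using u v by (simp add: mult_word_class h word_value_append[OF f])
  qed
  show "\<forall>a\<in>L. h (pres_gen L R a) = f a"
    using f by (auto simp: pres_gen_def h Pi_iff)
qed

lemma hom_eq_on_generators:
  assumes gen: "generate G (g ` I) = carrier G" and "group H"
    and "h \<in> hom G H" "h' \<in> hom G H" "\<And>i. i \<in> I \<Longrightarrow> h (g i) = h' (g i)"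
    and x: "x \<in> carrier G"
  shows "h x = h' x"
proof -
  interpret h: group_hom G H h using assms by (simp add: group_hom_def group_hom_axioms_def)
  interpret h': group_hom G H h' using assms by (simp add: group_hom_def group_hom_axioms_def)
  have gI: "g i \<in> carrier G" if "i \<in> I" for i
    using that generate.incl[of "g i" "g ` I" G] gen by simp
  have "x \<in> generate G (g ` I)" using x gen by simp
  then show ?thesis
  proof (induction rule: generate.induct)
    case (inv a)
    then obtain i where "i \<in> I" "a = g i" by blast
    then show ?case using assms(5)[of i] gI by simp
  next
    case (eng a b)
    then show ?case using gen by simp
  qed (use assms(5) in auto)
qed

text \<open>The constant \<^const>\<open>the_hom\<close> is a definite description.  This lemma and the next one give it
  meaning: on a generated group, one homomorphism with the right values on the generators pins it
  down.\<close>

lemma the_hom_eq: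
  assumes gen: "generate G (g ` I) = carrier G" and H: "group H"
    and h: "h \<in> hom G H" "\<And>i. i \<in> I \<Longrightarrow> h (g i) = f i"
  shows "the_hom G H I g f = restrict h (carrier G)"
  unfolding the_hom_def
proof (rule the_equality)
  have gI: "g i \<in> carrier G" if "i \<in> I" for i
    using that generate.incl[of "g i" "g ` I" G] gen by simp
  show "restrict h (carrier G) \<in> hom G H \<and> restrict h (carrier G) \<in> extensional (carrier G) \<and>
      (\<forall>i\<in>I. restrict h (carrier G) (g i) = f i)"
    using h gI by (auto simp: hom_def)
  fix k assume k: "k \<in> hom G H \<and> k \<in> extensional (carrier G) \<and> (\<forall>i\<in>I. k (g i) = f i)"
  have "k x = h x" if "x \<in> carrier G" for x
    by (rule hom_eq_on_generators[OF gen H]) (use k h that in auto)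
  then show "k = restrict h (carrier G)" using k by (auto simp: extensional_def fun_eq_iff)
qed

lemma the_hom_on_generated:
  assumes gen: "generate G (g ` I) = carrier G" and H: "group H"
    and ex: "\<exists>h\<in>hom G H. \<forall>i\<in>I. h (g i) = f i"
  shows "the_hom G H I g f \<in> hom G H" "\<And>i. i \<in> I \<Longrightarrow> the_hom G H I g f (g i) = f i"
proof -
  obtain h where h: "h \<in> hom G H" "\<And>i. i \<in> I \<Longrightarrow> h (g i) = f i" using ex by blast
  have gI: "g i \<in> carrier G" if "i \<in> I" for i
    using that generate.incl[of "g i" "g ` I" G] gen by simp
  have eq: "the_hom G H I g f = restrict h (carrier G)"
    by (rule the_hom_eq[OF gen H h(1)]) (rule h(2))
  show "the_hom G H I g f \<in> hom G H" "\<And>i. i \<in> I \<Longrightarrow> the_hom G H I g f (g i) = f i"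
    unfolding eq using h gI by (auto simp: hom_def)
qed

end

lemma pres_gen_closed: "a \<in> L \<Longrightarrow> pres_gen L R a \<in> carrier (presented_group L R)"
  by (auto simp: pres_gen_def presented_group_def)

lemma pres_gen_inv:
  assumes "a \<in> L"
  shows "inv\<^bsub>presented_group L R\<^esub> pres_gen L R a = word_class L R [(a, False)]"
proof -
  interpret group "presented_group L R" by (rule group_presented_group)
  have "word_class L R [(a, False)] \<otimes>\<^bsub>presented_group L R\<^esub> pres_gen L R a = word_class L R []"
    unfolding pres_gen_def using assms word_eq.cancel[of a L R False]
    by (subst mult_word_class) (simp_all add: word_class_eq_iff)
  also have "\<dots> = \<one>\<^bsub>presented_group L R\<^esub>" by (simp add: presented_group_def)
  finally show ?thesis
    using assms pres_gen_closed
    by (intro inv_equality) (auto simp: presented_group_def)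
qed

lemma word_value_pres_gen:
  assumes "u \<in> words L"
  shows "word_value (presented_group L R) (pres_gen L R) u = word_class L R u"
  using assms
proof (induction u)
  case Nil
  then show ?case by (simp add: presented_group_def)
next
  case (Cons l u)
  obtain a b where l: "l = (a, b)" by (cases l)
  have "(if b then pres_gen L R a else inv\<^bsub>presented_group L R\<^esub> pres_gen L R a) =
      word_class L R [(a, b)]"
    using Cons.prems by (simp add: l pres_gen_inv) (simp add: pres_gen_def)
  then show ?case using Cons mult_word_class[of "[(a, b)]" L u R] by (simp add: l)
qed

lemma pres_gen_relation:
  assumes "(u, v) \<in> R" "u \<in> words L" "v \<in> words L"
  shows "word_value (presented_group L R) (pres_gen L R) u =
    word_value (presented_group L R) (pres_gen L R) v"
  using assms by (simp add: word_value_pres_gen word_class_eq_iff word_eq.relation)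

lemma generate_pres_gen:
  "generate (presented_group L R) (pres_gen L R ` L) = carrier (presented_group L R)"
proof
  interpret group "presented_group L R" by (rule group_presented_group)
  show "generate (presented_group L R) (pres_gen L R ` L) \<subseteq> carrier (presented_group L R)"
    by (rule generate_incl) (auto intro: pres_gen_closed)
  have "word_value (presented_group L R) (pres_gen L R) u
      \<in> generate (presented_group L R) (pres_gen L R ` L)" if "u \<in> words L" for u
    using that
  proof (induction u)
    case (Cons l u)
    then show ?case
      by (cases l) (auto intro!: generate.eng intro: generate.incl generate.inv)
  qed (auto intro: generate.intros)
  then have "word_class L R ` words L \<subseteq> generate (presented_group L R) (pres_gen L R ` L)"
    by (auto simp: word_value_pres_gen)
  then show "carrier (presented_group L R) \<subseteq> generate (presented_group L R) (pres_gen L R ` L)"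
    by (simp add: presented_group_def)
qed

section \<open>The Coxeter presentation of the symmetric group\<close>

abbreviation adj :: "nat \<Rightarrow> nat \<Rightarrow> nat" where
  "adj i \<equiv> transpose i (Suc i)"

lemma adj_permutes: "a \<le> i \<Longrightarrow> i < b \<Longrightarrow> adj i permutes {a..b}"
  by (intro permutes_swap_id) auto

text \<open>Every transposition of two points of an interval is a product of adjacent transpositions of that
  interval, so induction over transpositions refines to induction over adjacent ones.  The interval is
  arbitrary because the stabiliser of the points \<open>1, \<dots>, l\<close> is the symmetric group of \<open>{l + 1..n}\<close>.\<close>

lemma permutes_adj_induct [consumes 1, case_names id adj]:
  assumes "p permutes {a..b::nat}" and id: "P id"
    and step: "\<And>i q. a \<le> i \<Longrightarrow> i < b \<Longrightarrow> q permutes {a..b} \<Longrightarrow> P q \<Longrightarrow> P (adj i \<circ> q)"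
  shows "P p"
proof -
  have seq: "apply_adj_transps xs \<circ> q permutes {a..b} \<and> P (apply_adj_transps xs \<circ> q)"
    if "set xs \<subseteq> {a..<b}" "q permutes {a..b}" "P q" for xs q
    using that(1)
  proof (induction xs)
    case (Cons i xs)
    have "apply_adj_transps (i # xs) \<circ> q = adj i \<circ> (apply_adj_transps xs \<circ> q)"
      by (simp add: fun_eq_iff)
    moreover have "a \<le> i" "i < b" using Cons.prems by auto
    ultimately show ?case
      using Cons step adj_permutes by (metis insert_subset list.simps(15) permutes_compose)
  qed (use that in simp)
  have ordered: "P (transpose c d \<circ> q)" if "c \<in> {a..b}" "d \<in> {a..b}" "c < d" "q permutes {a..b}" "P q"
    for c d q
    using seq[of "adj_transp_seq c d" q] that
    by (auto simp: set_adj_transp_seq adj_transp_seq_correct)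
  show ?thesis using assms(1) finite_atLeastAtMost id
  proof (induction rule: permutes_induct)
    case (swap c d q)
    then show ?case
      using ordered[of c d q] ordered[of d c q]
      by (metis linorder_neqE_nat transpose_commute)
  qed
qed

text \<open>These are the Coxeter relations.  The braid and commutation relations are imposed for only one
  order of the two indices; for the other order they are the same equations read backwards.\<close>

definition coxeter_family :: "('a, 'm) monoid_scheme \<Rightarrow> nat \<Rightarrow> (nat \<Rightarrow> 'a) \<Rightarrow> bool" where
  "coxeter_family H n r \<longleftrightarrow> r \<in> {1..<n} \<rightarrow> carrier H \<and>
    (\<forall>i\<in>{1..<n}. r i \<otimes>\<^bsub>H\<^esub> r i = \<one>\<^bsub>H\<^esub>) \<and>
    (\<forall>i. 1 \<le> i \<and> Suc i < n \<longrightarrow>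
      r i \<otimes>\<^bsub>H\<^esub> (r (Suc i) \<otimes>\<^bsub>H\<^esub> r i) = r (Suc i) \<otimes>\<^bsub>H\<^esub> (r i \<otimes>\<^bsub>H\<^esub> r (Suc i))) \<and>
    (\<forall>i j. 1 \<le> i \<and> Suc i < j \<and> j < n \<longrightarrow> r i \<otimes>\<^bsub>H\<^esub> r j = r j \<otimes>\<^bsub>H\<^esub> r i)"

lemma coxeter_family_adj: "coxeter_family (sym_group n) n adj"
  unfolding coxeter_family_def
  by (auto simp: sym_group_def adj_permutes) (auto simp: fun_eq_iff transpose_def)

text \<open>This is the product \<open>r\<^sub>k r\<^bsub>k+1\<^esub> \<cdots> r\<^bsub>n-1\<^esub>\<close>.  For the adjacent transpositions it is the cycle that
  takes \<open>n\<close> to \<open>k\<close> and each of \<open>k, \<dots>, n - 1\<close> to its successor, so these products represent the cosets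
  of the stabiliser of \<open>n\<close>.\<close>

definition climb :: "('a, 'm) monoid_scheme \<Rightarrow> (nat \<Rightarrow> 'a) \<Rightarrow> nat \<Rightarrow> nat \<Rightarrow> 'a" where
  "climb H r n k = foldr (\<lambda>i g. r i \<otimes>\<^bsub>H\<^esub> g) [k..<n] \<one>\<^bsub>H\<^esub>"

lemma climb_self [simp]: "climb H r n n = \<one>\<^bsub>H\<^esub>"
  by (simp add: climb_def)

lemma climb_step: "k < n \<Longrightarrow> climb H r n k = r k \<otimes>\<^bsub>H\<^esub> climb H r n (Suc k)"
  by (simp add: climb_def upt_conv_Cons)

locale coxeter = group H for H (structure) +
  fixes n :: nat and r :: "nat \<Rightarrow> 'a"
  assumes family: "coxeter_family H n r"
begin

lemma closed [simp]: "1 \<le> i \<Longrightarrow> i < n \<Longrightarrow> r i \<in> carrier H"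
  using family by (auto simp: coxeter_family_def Pi_iff)

lemma square: "1 \<le> i \<Longrightarrow> i < n \<Longrightarrow> r i \<otimes> r i = \<one>"
  using family by (auto simp: coxeter_family_def)

lemma braid: "1 \<le> i \<Longrightarrow> Suc i < n \<Longrightarrow> r i \<otimes> (r (Suc i) \<otimes> r i) = r (Suc i) \<otimes> (r i \<otimes> r (Suc i))"
  using family by (auto simp: coxeter_family_def)

lemma far_commute: "1 \<le> i \<Longrightarrow> Suc i < j \<Longrightarrow> j < n \<Longrightarrow> r i \<otimes> r j = r j \<otimes> r i"
  using family unfolding coxeter_family_def by blast

lemma climb_closed [simp]: "1 \<le> k \<Longrightarrow> k \<le> n \<Longrightarrow> climb H r n k \<in> carrier H"
proof (induction "n - k" arbitrary: k)
  case (Suc m)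
  then show ?case using Suc(1)[of "Suc k"] by (simp add: climb_step)
qed simp

lemma climb_commute:
  "\<lbrakk>1 \<le> i; Suc i < k; k \<le> n\<rbrakk> \<Longrightarrow> r i \<otimes> climb H r n k = climb H r n k \<otimes> r i"
proof (induction "n - k" arbitrary: k)
  case (Suc m)
  have c: "r i \<in> carrier H" "r k \<in> carrier H" "climb H r n (Suc k) \<in> carrier H"
    using Suc by auto
  have "r i \<otimes> (r k \<otimes> climb H r n (Suc k)) = r k \<otimes> (r i \<otimes> climb H r n (Suc k))"
    using far_commute[of i k] Suc(2-) c by (simp add: m_assoc[symmetric])
  then show ?case using Suc c Suc(1)[of "Suc k"] by (simp add: climb_step m_assoc)
qed simp

text \<open>Pushed past the factors of index below \<open>i\<close>, the letter \<open>r\<^bsub>i+1\<^esub>\<close> meets \<open>r\<^sub>i r\<^bsub>i+1\<^esub>\<close>, where the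
  braid relation turns it into \<open>r\<^sub>i\<close>; the remaining factors commute with \<open>r\<^sub>i\<close>.\<close>

lemma climb_shift:
  "\<lbrakk>1 \<le> k; k < Suc i; Suc i < n\<rbrakk> \<Longrightarrow> r (Suc i) \<otimes> climb H r n k = climb H r n k \<otimes> r i"
proof (induction "i - k" arbitrary: k)
  case 0
  then have k: "k = i" by simp
  let ?c = "climb H r n (Suc (Suc i))"
  have c: "r i \<in> carrier H" "r (Suc i) \<in> carrier H" "?c \<in> carrier H" using 0 by auto
  have "r (Suc i) \<otimes> climb H r n i = (r (Suc i) \<otimes> (r i \<otimes> r (Suc i))) \<otimes> ?c"
    using 0 k c by (simp add: climb_step m_assoc)
  also have "\<dots> = (r i \<otimes> (r (Suc i) \<otimes> r i)) \<otimes> ?c"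
    using 0 k by (simp add: braid)
  also have "\<dots> = r i \<otimes> (r (Suc i) \<otimes> (r i \<otimes> ?c))" using c by (simp add: m_assoc)
  also have "r i \<otimes> ?c = ?c \<otimes> r i" using 0 k by (intro climb_commute) auto
  also have "r i \<otimes> (r (Suc i) \<otimes> (?c \<otimes> r i)) = climb H r n i \<otimes> r i"
    using 0 k c by (simp add: climb_step m_assoc)
  finally show ?case by (simp add: k)
next
  case (Suc m)
  have c: "r i \<in> carrier H" "r (Suc i) \<in> carrier H" "r k \<in> carrier H"
    "climb H r n (Suc k) \<in> carrier H" using Suc by auto
  have "r (Suc i) \<otimes> (r k \<otimes> climb H r n (Suc k)) = r k \<otimes> (r (Suc i) \<otimes> climb H r n (Suc k))"
    using far_commute[of k "Suc i"] Suc(2-) c by (simp add: m_assoc[symmetric])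
  then show ?case using Suc c Suc(1)[of "Suc k"] by (simp add: climb_step m_assoc)
qed

end

lemma climb_adj_apply: "k \<le> n \<Longrightarrow> climb (sym_group m) adj n k n = k"
proof (induction "n - k" arbitrary: k)
  case (Suc d)
  then show ?case using Suc(1)[of "Suc k"] by (simp add: climb_step sym_group_def)
qed (simp add: sym_group_def)

text \<open>The Coxeter relations suffice to define a homomorphism on the symmetric group.  In the inductive
  step a permutation of \<open>{1..n + 1}\<close> is written uniquely as \<open>c\<^sub>k u\<close> with \<open>c\<^sub>k = s\<^sub>k \<cdots> s\<^sub>n\<close> and \<open>u\<close> fixing
  \<open>n + 1\<close>, and its value is \<open>r\<^sub>k \<cdots> r\<^sub>n\<close> times the value of \<open>u\<close>.  Left multiplication by \<open>s\<^sub>i\<close> changes the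
  normal form in the same way as left multiplication by \<open>r\<^sub>i\<close> changes the value, because only the
  Coxeter relations are used to restore the normal form.\<close>

lemma coxeter_hom_exists:
  assumes "group H" "coxeter_family H n r"
  shows "\<exists>h\<in>hom (sym_group n) H. \<forall>i\<in>{1..<n}. h (adj i) = r i"
  using assms(2)
proof (induction n)
  case 0
  interpret group H by fact
  have "(\<lambda>_. \<one>\<^bsub>H\<^esub>) \<in> hom (sym_group 0) H" by (auto simp: hom_def)
  then show ?case by force
next
  case (Suc n)
  interpret H: coxeter H "Suc n" r using assms(1) Suc.prems by (simp add: coxeter_def coxeter_axioms_def)
  interpret S: coxeter "sym_group (Suc n)" "Suc n" adj
    using sym_group_is_group coxeter_family_adj by (simp add: coxeter_def coxeter_axioms_def)
  have "coxeter_family H n r"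
    using Suc.prems unfolding coxeter_family_def by (auto simp: Pi_iff) (meson less_SucI)
  then obtain h where h: "h \<in> hom (sym_group n) H" and h_adj: "\<And>i. i \<in> {1..<n} \<Longrightarrow> h (adj i) = r i"
    using Suc.IH by blast
  interpret h: group_hom "sym_group n" H h
    using h assms(1) sym_group_is_group by (simp add: group_hom_def group_hom_axioms_def)
  let ?c = "climb (sym_group (Suc n)) adj (Suc n)" and ?d = "climb H r (Suc n)"
  have mult: "f \<otimes>\<^bsub>sym_group m\<^esub> g = f \<circ> g" for f g m by (simp add: sym_group_def)
  have carr: "f \<in> carrier (sym_group m) \<longleftrightarrow> f permutes {1..m}" for f m by (simp add: sym_group_def)
  have c_perm: "?c k permutes {1..Suc n}" if "1 \<le> k" "k \<le> Suc n" for k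
    using S.climb_closed[OF that] by (simp add: carr)
  \<comment> \<open>The image of \<open>n + 1\<close> determines the coset representative of \<open>w\<close>.\<close>
  define h' where "h' w = ?d (w (Suc n)) \<otimes>\<^bsub>H\<^esub> h (inv' (?c (w (Suc n))) \<circ> w)" for w
  have h': "h' (?c k \<circ> u) = ?d k \<otimes>\<^bsub>H\<^esub> h u" if "1 \<le> k" "k \<le> Suc n" "u permutes {1..n}" for k u
  proof -
    have "u (Suc n) = Suc n" using that(3) by (auto intro: permutes_not_in)
    moreover have "inv' (?c k) \<circ> (?c k \<circ> u) = u"
      using permutes_inv_o(2)[OF c_perm[OF that(1,2)]] by (simp add: comp_assoc[symmetric])
    ultimately show ?thesis using that by (simp add: h'_def climb_adj_apply)
  qed
  have decomp: "\<exists>k u. 1 \<le> k \<and> k \<le> Suc n \<and> u permutes {1..n} \<and> w = ?c k \<circ> u"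
    if w: "w permutes {1..Suc n}" for w
  proof -
    let ?k = "w (Suc n)"
    have k: "1 \<le> ?k" "?k \<le> Suc n" using permutes_in_image[OF w, of "Suc n"] by auto
    note c = c_perm[OF k]
    have "inv' (?c ?k) \<circ> w permutes {1..Suc n}" using w c by (intro permutes_compose permutes_inv)
    moreover have "(inv' (?c ?k) \<circ> w) (Suc n) = Suc n"
      using permutes_inv_eq[OF c] k by (simp add: climb_adj_apply)
    ultimately have "inv' (?c ?k) \<circ> w permutes {1..n}"
      by (elim permutes_superset) (auto simp: le_Suc_eq)
    moreover have "w = ?c ?k \<circ> (inv' (?c ?k) \<circ> w)"
      using permutes_inv_o(1)[OF c] by (simp add: comp_assoc[symmetric])
    ultimately show ?thesis using k by blast
  qed
  have h_closed: "h u \<in> carrier H" if "u permutes {1..n}" for u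
    using that h.hom_closed by (simp add: carr)
  have h_step: "h (adj i \<circ> u) = r i \<otimes>\<^bsub>H\<^esub> h u" if "1 \<le> i" "i < n" "u permutes {1..n}" for i u
    using h.hom_mult[of "adj i" u] that h_adj[of i] by (simp add: carr mult adj_permutes)
  have left: "h' (adj i \<circ> w) = r i \<otimes>\<^bsub>H\<^esub> h' w"
    if i: "1 \<le> i" "i < Suc n" and w: "w permutes {1..Suc n}" for i w
  proof -
    obtain k u where k: "1 \<le> k" "k \<le> Suc n" and u: "u permutes {1..n}" and wk: "w = ?c k \<circ> u"
      using decomp[OF w] by blast
    have rc: "r i \<in> carrier H" "?d k \<in> carrier H" "h u \<in> carrier H"
      using i k h_closed[OF u] by auto
    \<comment> \<open>In the outer cases \<open>s\<^sub>i\<close> passes through \<open>c\<^sub>k\<close> and acts on \<open>u\<close>; in the two middle cases it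
      lengthens or shortens \<open>c\<^sub>k\<close> by one letter.\<close>
    consider "Suc i < k" | "Suc i = k" | "i = k" | j where "k < Suc j" "i = Suc j"
      by (cases i) force+
    then show ?thesis
    proof cases
      case 1
      then have iu: "adj i \<circ> u permutes {1..n}"
        using i k u by (intro permutes_compose adj_permutes) auto
      have "adj i \<circ> w = ?c k \<circ> (adj i \<circ> u)"
        using S.climb_commute[of i k] 1 i k by (simp add: mult wk comp_assoc[symmetric])
      then show ?thesis
        using h'[OF k iu] h'[OF k u] 1 i k u rc H.climb_commute[of i k]
        by (simp add: wk h_step H.m_assoc[symmetric])
    next
      case 2
      have "adj i \<circ> ?c k = ?c i" "?d i = r i \<otimes>\<^bsub>H\<^esub> ?d k"
        using 2 i k by (simp_all add: climb_step mult)
      then show ?thesis using h'[of i u] h'[of k u] 2 i k u rc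
        by (simp add: wk comp_assoc[symmetric] H.m_assoc[symmetric])
    next
      case 3
      have d: "?d (Suc i) \<in> carrier H" using i by simp
      have "?c k = adj i \<circ> ?c (Suc i)" "?d k = r i \<otimes>\<^bsub>H\<^esub> ?d (Suc i)"
        using 3 i k by (simp_all add: climb_step mult)
      moreover from this have "adj i \<circ> ?c k = ?c (Suc i)" by (simp add: comp_assoc[symmetric])
      moreover have "r i \<otimes>\<^bsub>H\<^esub> (r i \<otimes>\<^bsub>H\<^esub> ?d (Suc i)) = ?d (Suc i)"
        using i d rc H.square[of i] by (simp add: H.m_assoc[symmetric])
      ultimately show ?thesis using h'[of "Suc i" u] h'[OF k u] 3 i k u rc d
        by (simp add: wk comp_assoc[symmetric] H.m_assoc[symmetric])
    next
      case 4
      then have iu: "adj j \<circ> u permutes {1..n}"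
        using i k u by (intro permutes_compose adj_permutes) auto
      have "adj i \<circ> w = ?c k \<circ> (adj j \<circ> u)"
        using S.climb_shift[of k j] 4 i k by (simp add: mult wk comp_assoc[symmetric])
      then show ?thesis
        using h'[OF k iu] h'[OF k u] 4 i k u rc H.climb_shift[of k j]
        by (simp add: wk h_step H.m_assoc[symmetric])
    qed
  qed
  have h'_closed: "h' w \<in> carrier H" if "w permutes {1..Suc n}" for w
    using decomp[OF that] h' h_closed by auto
  have h'_id: "h' id = \<one>\<^bsub>H\<^esub>"
    using h'[of "Suc n" id] h.hom_one by (simp add: sym_group_def permutes_id)
  have h'_mult: "h' (v \<circ> w) = h' v \<otimes>\<^bsub>H\<^esub> h' w"
    if "v permutes {1..Suc n}" and w: "w permutes {1..Suc n}" for v w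
    using that(1)
  proof (induction rule: permutes_adj_induct)
    case id
    show ?case using H.l_one[OF h'_closed[OF w]] by (simp only: h'_id id_comp)
  next
    case (adj i q)
    then have c: "r i \<in> carrier H" "h' q \<in> carrier H" using h'_closed by auto
    note qw = permutes_compose[OF w adj(3)]
    have "h' ((adj i \<circ> q) \<circ> w) = r i \<otimes>\<^bsub>H\<^esub> h' (q \<circ> w)"
      unfolding comp_assoc using adj by (intro left qw) auto
    also have "\<dots> = r i \<otimes>\<^bsub>H\<^esub> (h' q \<otimes>\<^bsub>H\<^esub> h' w)" by (simp only: adj(4))
    also have "\<dots> = (r i \<otimes>\<^bsub>H\<^esub> h' q) \<otimes>\<^bsub>H\<^esub> h' w"
      using c h'_closed[OF w] by (simp only: H.m_assoc)
    also have "r i \<otimes>\<^bsub>H\<^esub> h' q = h' (adj i \<circ> q)"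
      using adj by (intro left[symmetric]) auto
    finally show ?case .
  qed
  have "h' \<in> hom (sym_group (Suc n)) H"
    using h'_closed h'_mult by (auto simp: hom_def sym_group_def)
  moreover have "h' (adj i) = r i" if "i \<in> {1..<Suc n}" for i
    using left[of i id] that by (simp add: h'_id permutes_id)
  ultimately show ?case by blast
qed

lemma generate_adj: "generate (sym_group n) (adj ` {1..<n}) = carrier (sym_group n)"
proof
  interpret group "sym_group n" by (rule sym_group_is_group)
  show "generate (sym_group n) (adj ` {1..<n}) \<subseteq> carrier (sym_group n)"
    by (rule generate_incl) (auto simp: sym_group_def adj_permutes)
  show "carrier (sym_group n) \<subseteq> generate (sym_group n) (adj ` {1..<n})"
  proof
    fix p assume "p \<in> carrier (sym_group n)"
    then have "p permutes {1..n}" by (simp add: sym_group_def)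
    then show "p \<in> generate (sym_group n) (adj ` {1..<n})"
    proof (induction rule: permutes_adj_induct)
      case id
      show ?case using generate.one[of "sym_group n"] by (simp only: sym_group_one)
    next
      case (adj i q)
      then have "adj i \<in> generate (sym_group n) (adj ` {1..<n})" by (intro generate.incl) auto
      from generate.eng[OF this adj(4)] show ?case by (simp only: sym_group_mult)
    qed
  qed
qed

section \<open>The elements \<open>\<delta>\<^sub>y\<close> of the virtual cactus group\<close>

abbreviation interval :: "nat \<Rightarrow> nat \<Rightarrow> nat list" where
  "interval p q \<equiv> [p..<Suc q]"

lemma group_VJ: "group (VJ n)"
  unfolding VJ_def by (rule group_presented_group)

lemma generate_vj_gen: "generate (VJ n) (vj_gen n ` vj_letters n) = carrier (VJ n)"
  unfolding VJ_def vj_gen_def by (rule generate_pres_gen)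

lemma X_in_vj_letters [simp]: "X p q \<in> vj_letters n \<longleftrightarrow> 1 \<le> p \<and> p < q \<and> q \<le> n"
  by (auto simp: vj_letters_def)

lemma Rho_in_vj_letters [simp]: "Rho i \<in> vj_letters n \<longleftrightarrow> 1 \<le> i \<and> i < n"
  by (auto simp: vj_letters_def)

lemma vj_gen_closed: "l \<in> vj_letters n \<Longrightarrow> vj_gen n l \<in> carrier (VJ n)"
  unfolding VJ_def vj_gen_def by (rule pres_gen_closed)

lemma vj_relation:
  assumes "(pos_word us, pos_word vs) \<in> vj_rels n" "set us \<subseteq> vj_letters n" "set vs \<subseteq> vj_letters n"
  shows "word_value (VJ n) (vj_gen n) (pos_word us) = word_value (VJ n) (vj_gen n) (pos_word vs)"
  using assms unfolding VJ_def vj_gen_def by (intro pres_gen_relation) auto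

lemma vj_X_closed [simp]: "1 \<le> p \<Longrightarrow> p < q \<Longrightarrow> q \<le> n \<Longrightarrow> vj_gen n (X p q) \<in> carrier (VJ n)"
  by (simp add: vj_gen_closed)

lemma vj_Rho_closed [simp]: "1 \<le> i \<Longrightarrow> i < n \<Longrightarrow> vj_gen n (Rho i) \<in> carrier (VJ n)"
  by (simp add: vj_gen_closed)

text \<open>This lets a word in the \<open>\<rho>\<^sub>i\<close>, such as the one in the last defining relation, be handled as a single
  permutation.\<close>

lemma hom_apply_adj_transps:
  assumes "group H" and h: "h \<in> hom (sym_group n) H"
    and f: "\<And>i. 1 \<le> i \<Longrightarrow> i < n \<Longrightarrow> f (Rho i) = h (adj i)" and "set is \<subseteq> {1..<n}"
  shows "word_value H f (pos_word (map Rho is)) = h (apply_adj_transps is)"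
  using assms(4)
proof (induction "is")
  case Nil
  have "h id = \<one>\<^bsub>H\<^esub>" using hom_one[OF h sym_group_is_group \<open>group H\<close>] by (simp only: sym_group_one)
  then show ?case unfolding list.map word_value_pos_word apply_adj_transps_Nil by (rule HOL.sym)
next
  case (Cons i "is")
  then have i: "adj i permutes {1..n}" "apply_adj_transps is permutes {1..n}"
    using adj_permutes[of 1 i n] by (auto intro!: permutes_apply_adj_transps)
  have "h (adj i \<circ> apply_adj_transps is) = h (adj i) \<otimes>\<^bsub>H\<^esub> h (apply_adj_transps is)"
    using hom_mult[OF h] i by (simp only: sym_group_carrier sym_group_mult)
  also have "\<dots> = f (Rho i) \<otimes>\<^bsub>H\<^esub> word_value H f (pos_word (map Rho is))"
    using Cons f by simp
  finally show ?case
    unfolding list.map word_value_pos_word apply_adj_transps_Cons Suc_eq_plus1[symmetric] by (rule HOL.sym)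
qed

context
  fixes n :: nat
begin

interpretation group "VJ n" by (rule group_VJ)

lemma vj_X_square:
  assumes "1 \<le> p" "p < q" "q \<le> n"
  shows "vj_gen n (X p q) \<otimes>\<^bsub>VJ n\<^esub> vj_gen n (X p q) = \<one>\<^bsub>VJ n\<^esub>"
  using vj_relation[of "[X p q, X p q]" "[]" n] assms by (simp add: vj_rels_def pos_word_def)

lemma vj_X_commute:
  assumes "1 \<le> p" "p < q" "q \<le> n" "1 \<le> m" "m < r" "r \<le> n" "{p..q} \<inter> {m..r} = {}"
  shows "vj_gen n (X p q) \<otimes>\<^bsub>VJ n\<^esub> vj_gen n (X m r) = vj_gen n (X m r) \<otimes>\<^bsub>VJ n\<^esub> vj_gen n (X p q)"
proof -
  have "(pos_word [X p q, X m r], pos_word [X m r, X p q]) \<in> vj_rels n"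
    using assms unfolding vj_rels_def by blast
  from vj_relation[OF this] show ?thesis using assms by simp
qed

lemma vj_X_nested:
  assumes "1 \<le> p" "p \<le> m" "m < r" "r \<le> q" "q \<le> n"
  shows "vj_gen n (X p q) \<otimes>\<^bsub>VJ n\<^esub> vj_gen n (X m r) =
    vj_gen n (X (p + q - r) (p + q - m)) \<otimes>\<^bsub>VJ n\<^esub> vj_gen n (X p q)"
proof -
  have "p < q" "1 \<le> m" "r \<le> n" "{m..r} \<subseteq> {p..q}" using assms by auto
  then have "(pos_word [X p q, X m r], pos_word [X (p + q - r) (p + q - m), X p q]) \<in> vj_rels n"
    using assms unfolding vj_rels_def by blast
  moreover have "1 \<le> p + q - r" "p + q - r < p + q - m" "p + q - m \<le> n" using assms by auto
  ultimately show ?thesis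
    using vj_relation[of "[X p q, X m r]" "[X (p + q - r) (p + q - m), X p q]" n] assms by simp
qed

lemma vj_Rho_X_commute:
  assumes "1 \<le> i" "i < n" "1 \<le> p" "p < q" "q \<le> n" "i < p - 1 \<or> i \<ge> q + 1"
  shows "vj_gen n (Rho i) \<otimes>\<^bsub>VJ n\<^esub> vj_gen n (X p q) = vj_gen n (X p q) \<otimes>\<^bsub>VJ n\<^esub> vj_gen n (Rho i)"
proof -
  have "i \<le> n - 1" using assms by simp
  then have "(pos_word [Rho i, X p q], pos_word [X p q, Rho i]) \<in> vj_rels n"
    using assms unfolding vj_rels_def by blast
  from vj_relation[OF this] show ?thesis using assms by simp
qed

lemma coxeter_family_Rho: "coxeter_family (VJ n) n (\<lambda>i. vj_gen n (Rho i))"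
proof -
  have square: "vj_gen n (Rho i) \<otimes>\<^bsub>VJ n\<^esub> vj_gen n (Rho i) = \<one>\<^bsub>VJ n\<^esub>" if "1 \<le> i" "i < n" for i
  proof -
    have "(pos_word [Rho i, Rho i], pos_word []) \<in> vj_rels n"
      using that by (auto simp: vj_rels_def pos_word_def)
    from vj_relation[OF this] show ?thesis using that by simp
  qed
  have braid: "vj_gen n (Rho i) \<otimes>\<^bsub>VJ n\<^esub> (vj_gen n (Rho (Suc i)) \<otimes>\<^bsub>VJ n\<^esub> vj_gen n (Rho i)) =
      vj_gen n (Rho (Suc i)) \<otimes>\<^bsub>VJ n\<^esub> (vj_gen n (Rho i) \<otimes>\<^bsub>VJ n\<^esub> vj_gen n (Rho (Suc i)))"
    if "1 \<le> i" "Suc i < n" for i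
  proof -
    have "i \<le> n - 1" "1 \<le> Suc i" "Suc i \<le> n - 1" "\<bar>int i - int (Suc i)\<bar> = 1" using that by auto
    then have "(pos_word [Rho i, Rho (Suc i), Rho i], pos_word [Rho (Suc i), Rho i, Rho (Suc i)])
        \<in> vj_rels n"
      using that unfolding vj_rels_def by blast
    from vj_relation[OF this] show ?thesis using that by simp
  qed
  have far: "vj_gen n (Rho i) \<otimes>\<^bsub>VJ n\<^esub> vj_gen n (Rho j) =
      vj_gen n (Rho j) \<otimes>\<^bsub>VJ n\<^esub> vj_gen n (Rho i)" if "1 \<le> i" "Suc i < j" "j < n" for i j
  proof -
    have "i \<le> n - 1" "1 \<le> j" "j \<le> n - 1" "\<bar>int i - int j\<bar> > 1" using that by auto
    then have "(pos_word [Rho i, Rho j], pos_word [Rho j, Rho i]) \<in> vj_rels n"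
      using that unfolding vj_rels_def by blast
    from vj_relation[OF this] show ?thesis using that by simp
  qed
  from square braid far show ?thesis
    unfolding coxeter_family_def
    by (intro conjI ballI allI impI funcsetI) (simp, simp, blast, blast)
qed

lemma iota_S_hom: "iota_S n \<in> hom (sym_group n) (VJ n)"
  and iota_S_adj: "1 \<le> i \<Longrightarrow> i < n \<Longrightarrow> iota_S n (adj i) = vj_gen n (Rho i)"
proof -
  have I: "{1..n - 1} = {1..<n}" by auto
  have gen: "generate (sym_group n) ((\<lambda>i. transpose i (i + 1)) ` {1..n - 1}) = carrier (sym_group n)"
    unfolding I Suc_eq_plus1[symmetric] by (rule generate_adj)
  have ex: "\<exists>h\<in>hom (sym_group n) (VJ n). \<forall>i\<in>{1..n - 1}. h (transpose i (i + 1)) = vj_gen n (Rho i)"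
    unfolding I Suc_eq_plus1[symmetric] by (rule coxeter_hom_exists[OF group_VJ coxeter_family_Rho])
  note the = group.the_hom_on_generated[OF sym_group_is_group gen group_VJ ex]
  show "iota_S n \<in> hom (sym_group n) (VJ n)"
    unfolding iota_S_def by (rule the(1))
  show "iota_S n (adj i) = vj_gen n (Rho i)" if "1 \<le> i" "i < n"
    using the(2)[of i] that unfolding iota_S_def by auto
qed

interpretation iota: group_hom "sym_group n" "VJ n" "iota_S n"
  using iota_S_hom group_VJ sym_group_is_group by (simp add: group_hom_def group_hom_axioms_def)

lemma iota_S_closed [simp]: "w permutes {1..n} \<Longrightarrow> iota_S n w \<in> carrier (VJ n)"
  using iota.hom_closed by (simp add: sym_group_carrier)

lemma iota_S_comp:
  "v permutes {1..n} \<Longrightarrow> w permutes {1..n} \<Longrightarrow>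
    iota_S n (v \<circ> w) = iota_S n v \<otimes>\<^bsub>VJ n\<^esub> iota_S n w"
  using iota.hom_mult[of v w] by (simp add: sym_group_carrier sym_group_mult)

lemma iota_S_id: "iota_S n id = \<one>\<^bsub>VJ n\<^esub>"
  using iota.hom_one by (simp only: sym_group_one)

definition conj_by :: "(nat \<Rightarrow> nat) \<Rightarrow> vj_letter word set \<Rightarrow> vj_letter word set" where
  "conj_by w g = iota_S n w \<otimes>\<^bsub>VJ n\<^esub> g \<otimes>\<^bsub>VJ n\<^esub> inv\<^bsub>VJ n\<^esub> iota_S n w"

lemma conj_by_closed [simp]:
  "w permutes {1..n} \<Longrightarrow> g \<in> carrier (VJ n) \<Longrightarrow> conj_by w g \<in> carrier (VJ n)"
  by (simp add: conj_by_def)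

lemma conj_by_mult:
  assumes "w permutes {1..n}" "g \<in> carrier (VJ n)" "h \<in> carrier (VJ n)"
  shows "conj_by w (g \<otimes>\<^bsub>VJ n\<^esub> h) = conj_by w g \<otimes>\<^bsub>VJ n\<^esub> conj_by w h"
  unfolding conj_by_def using assms by (simp add: m_assoc inv_solve_left)

lemma conj_by_hom: "w permutes {1..n} \<Longrightarrow> conj_by w \<in> hom (VJ n) (VJ n)"
  by (rule homI) (simp_all add: conj_by_mult)

lemma conj_by_comp:
  assumes "v permutes {1..n}" "w permutes {1..n}" "g \<in> carrier (VJ n)"
  shows "conj_by (v \<circ> w) g = conj_by v (conj_by w g)"
  unfolding conj_by_def using assms by (simp add: iota_S_comp inv_mult_group m_assoc)

lemma conj_by_eq_iff:
  assumes "w permutes {1..n}" "g \<in> carrier (VJ n)" "h \<in> carrier (VJ n)"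
  shows "conj_by w g = h \<longleftrightarrow> iota_S n w \<otimes>\<^bsub>VJ n\<^esub> g = h \<otimes>\<^bsub>VJ n\<^esub> iota_S n w"
  unfolding conj_by_def using assms by (metis inv_solve_right iota_S_closed m_closed)

lemma conj_by_id: "g \<in> carrier (VJ n) \<Longrightarrow> conj_by id g = g"
  by (simp add: conj_by_eq_iff iota_S_id permutes_id)

text \<open>A permutation fixing \<open>1, \<dots>, l\<close> is a product of \<open>s\<^sub>i\<close> with \<open>i > l\<close>, and each such \<open>\<rho>\<^sub>i\<close> commutes with
  \<open>x\<^sub>1\<^sub>,\<^sub>l\<close>.  Hence \<open>\<delta>\<^sub>y\<close> does not depend on the permutation chosen to define it.\<close>

lemma conj_by_fixing:
  assumes l: "2 \<le> l" "l \<le> n" and u: "u permutes {1..n}" and fixed: "\<And>i. i \<in> {1..l} \<Longrightarrow> u i = i"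
  shows "conj_by u (vj_gen n (X 1 l)) = vj_gen n (X 1 l)"
proof -
  have X: "vj_gen n (X 1 l) \<in> carrier (VJ n)" using l by simp
  have "u permutes {l + 1..n}"
    using u by (rule permutes_superset) (use fixed in \<open>auto simp: not_less_eq_eq\<close>)
  then show ?thesis
  proof (induction rule: permutes_adj_induct)
    case id
    show ?case by (rule conj_by_id[OF X])
  next
    case (adj i q)
    have q: "q permutes {1..n}" using adj(3) by (rule permutes_subset) auto
    have "conj_by (adj i) (vj_gen n (X 1 l)) = vj_gen n (X 1 l)"
      using adj l vj_Rho_X_commute[of i 1 l] adj_permutes[of 1 i n]
      by (simp add: conj_by_eq_iff iota_S_adj)
    moreover have "conj_by (adj i \<circ> q) (vj_gen n (X 1 l)) = conj_by (adj i) (conj_by q (vj_gen n (X 1 l)))"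
      using adj l q by (intro conj_by_comp adj_permutes) auto
    ultimately show ?case by (simp only: adj(4))
  qed
qed

text \<open>The entries are placed one at a time: a transposition puts the new entry in its position and
  disturbs no earlier one, since neither of the two values it exchanges has been used.\<close>

lemma extend_to_permutation:
  assumes "distinct y" "set y \<subseteq> {1..n}" "length y \<le> n"
  shows "\<exists>w. w permutes {1..n} \<and> (\<forall>i\<in>{1..length y}. w i = y ! (i - 1))"
  using assms
proof (induction y rule: rev_induct)
  case Nil
  then show ?case by (auto intro: permutes_id)
next
  case (snoc a y)
  then obtain w where w: "w permutes {1..n}" "\<And>i. i \<in> {1..length y} \<Longrightarrow> w i = y ! (i - 1)" by auto
  let ?b = "w (Suc (length y))"
  let ?w = "transpose ?b a \<circ> w"
  have "?b \<in> {1..n}" using permutes_in_image[OF w(1)] snoc.prems by simp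
  then have "?w permutes {1..n}"
    using snoc.prems by (intro permutes_compose[OF w(1)] permutes_swap_id) auto
  moreover have "?w i = (y @ [a]) ! (i - 1)" if "i \<in> {1..length (y @ [a])}" for i
  proof (cases "i = Suc (length y)")
    case False
    then have i: "i \<in> {1..length y}" using that by auto
    then have "y ! (i - 1) \<in> set y" by (intro nth_mem) auto
    then have "w i \<noteq> a" using w(2)[OF i] snoc.prems by auto
    moreover have "w i \<noteq> ?b" using permutes_inj[OF w(1)] False by (auto dest: injD)
    moreover have "i - 1 < length y" using i by auto
    ultimately show ?thesis using w(2)[OF i] by (simp add: nth_append)
  qed simp
  ultimately show ?case by blast
qed

lemma delta_eq:
  assumes y: "y \<in> tuples n" and w: "w permutes {1..n}"
    and wy: "\<forall>i\<in>{1..length y}. w i = y ! (i - 1)"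
  shows "delta n y = conj_by w (vj_gen n (X 1 (length y)))"
proof -
  let ?X = "vj_gen n (X 1 (length y))"
  let ?P = "\<lambda>w. w permutes {1..n} \<and> (\<forall>i\<in>{1..length y}. w i = y ! (i - 1))"
  define v where "v = (SOME w. ?P w)"
  have "?P w" using w wy by blast
  then have v: "?P v" unfolding v_def by (rule someI[of ?P])
  have l: "2 \<le> length y" "length y \<le> n" using y by (auto simp: tuples_def)
  have X: "?X \<in> carrier (VJ n)" using l by simp
  have u: "inv' w \<circ> v permutes {1..n}" using v w by (intro permutes_compose permutes_inv) auto
  have "(inv' w \<circ> v) i = i" if "i \<in> {1..length y}" for i
    using v that bspec[OF wy that] permutes_inverses(2)[OF w] by (metis comp_apply)
  from conj_by_fixing[OF l u this] have "conj_by (inv' w \<circ> v) ?X = ?X" .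
  moreover have "v = w \<circ> (inv' w \<circ> v)"
    using permutes_inv_o(1)[OF w] by (simp add: comp_assoc[symmetric])
  ultimately have "conj_by v ?X = conj_by w ?X" using conj_by_comp[OF w u X] by simp
  moreover have "delta n y = conj_by v ?X"
    by (simp add: delta_def Let_def conj_by_def v_def sym_group_carrier)
  ultimately show ?thesis by simp
qed

lemma map_permutation_tuples:
  assumes "v permutes {1..n}" "y \<in> tuples n"
  shows "map v y \<in> tuples n"
proof -
  have "set (map v y) \<subseteq> {1..n}"
    using assms permutes_in_image[OF assms(1)] by (auto simp: tuples_def)
  moreover have "distinct (map v y)"
    using assms permutes_inj_on[OF assms(1)] by (auto simp: tuples_def distinct_map)
  ultimately show ?thesis using assms(2) by (simp add: tuples_def)
qed

lemma tuple_permutation: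
  assumes "y \<in> tuples n"
  obtains w where "w permutes {1..n}" "\<forall>i\<in>{1..length y}. w i = y ! (i - 1)"
  using extend_to_permutation[of y] assms by (auto simp: tuples_def)

lemma delta_closed [simp]: "y \<in> tuples n \<Longrightarrow> delta n y \<in> carrier (VJ n)"
proof -
  assume y: "y \<in> tuples n"
  obtain w where "w permutes {1..n}" "\<forall>i\<in>{1..length y}. w i = y ! (i - 1)"
    by (rule tuple_permutation[OF y]) blast
  from delta_eq[OF y this] this(1) show ?thesis using y by (simp add: tuples_def)
qed

text \<open>If \<open>w\<close> takes \<open>(1, \<dots>, l)\<close> to \<open>y\<close>, then \<open>v \<circ> w\<close> takes it to \<open>v y\<close>.\<close>

lemma conj_by_delta:
  assumes v: "v permutes {1..n}" and y: "y \<in> tuples n"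
  shows "conj_by v (delta n y) = delta n (map v y)"
proof -
  obtain w where w: "w permutes {1..n}" "\<forall>i\<in>{1..length y}. w i = y ! (i - 1)"
    by (rule tuple_permutation[OF y]) blast
  have "delta n (map v y) = conj_by (v \<circ> w) (vj_gen n (X 1 (length (map v y))))"
    using w by (intro delta_eq permutes_compose map_permutation_tuples v y) auto
  also have "\<dots> = conj_by v (conj_by w (vj_gen n (X 1 (length y))))"
    using v w y by (simp add: conj_by_comp tuples_def)
  also have "\<dots> = conj_by v (delta n y)" using delta_eq[OF y w] by simp
  finally show ?thesis by simp
qed

lemma interval_tuples: "1 \<le> p \<Longrightarrow> p < q \<Longrightarrow> q \<le> n \<Longrightarrow> interval p q \<in> tuples n"
  by (auto simp: tuples_def simp del: upt_Suc)

lemma conj_by_inj: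
  assumes w: "w permutes {1..n}" and c: "g \<in> carrier (VJ n)" "h \<in> carrier (VJ n)"
    and eq: "conj_by w g = conj_by w h"
  shows "g = h"
proof -
  have "conj_by (inv' w) (conj_by w k) = k" if "k \<in> carrier (VJ n)" for k
    using that conj_by_comp[OF permutes_inv[OF w] w that] permutes_inv_o(2)[OF w] conj_by_id by simp
  then show ?thesis using c eq by metis
qed

text \<open>The permutation \<open>s\<^sub>q \<cdots> s\<^sub>p\<close> of the last defining relation; it lowers each of \<open>p + 1, \<dots>, q + 1\<close>
  by one.\<close>

abbreviation shift :: "nat \<Rightarrow> nat \<Rightarrow> nat \<Rightarrow> nat" where
  "shift p q \<equiv> apply_adj_transps (rev [p..<Suc q])"

lemma shift_permutes: "a \<le> p \<Longrightarrow> q < b \<Longrightarrow> shift p q permutes {a..b}"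
  by (rule permutes_apply_adj_transps) auto

lemma shift_apply:
  assumes "p \<le> q" "p < j" "j \<le> Suc q" shows "shift p q j = j - 1"
  using assms
proof (induction q rule: dec_induct)
  case base
  then have "j = Suc p" by simp
  then show ?case by simp
next
  case (step q)
  have split: "shift p (Suc q) j = adj (Suc q) (shift p q j)"
    using step.hyps by (simp add: fun_eq_iff)
  show ?case
  proof (cases "j = Suc (Suc q)")
    case True
    have "shift p q j = j"
      using permutes_not_in[OF shift_permutes[of p p q "Suc q"], of j] True by auto
    then show ?thesis using split True by simp
  next
    case False
    then have "shift p q j = j - 1" using step by simp
    then show ?thesis using split False step.prems by simp
  qed
qed

lemma map_shift_interval:
  assumes "p \<le> q" shows "map (shift p q) (interval (Suc p) (Suc q)) = interval p q"
proof (rule nth_equalityI)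
  fix i assume "i < length (map (shift p q) (interval (Suc p) (Suc q)))"
  then have i: "i < Suc q - p" by (simp del: upt_Suc)
  then have "shift p q (Suc p + i) = p + i" using assms by (subst shift_apply) auto
  then show "map (shift p q) (interval (Suc p) (Suc q)) ! i = interval p q ! i"
    using i by (simp del: upt_Suc)
qed (simp del: upt_Suc)

lemma conj_by_shift:
  assumes "1 \<le> p" "p < q" "q < n"
  shows "conj_by (shift p q) (vj_gen n (X (Suc p) (Suc q))) = vj_gen n (X p q)"
proof -
  let ?r = "rev [p..<q + 1]"
  have r: "set ?r \<subseteq> {1..<n}" using assms by auto
  then have R: "map (\<lambda>a. (a, True)) (map Rho ?r) \<in> words (vj_letters n)"
    using pos_word_in_words[of "map Rho ?r" "vj_letters n"] assms unfolding pos_word_def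
    by (auto simp del: upt_Suc)
  have "(pos_word (X p q # map Rho ?r), pos_word (map Rho ?r @ [X (p + 1) (q + 1)])) \<in> vj_rels n"
    using assms unfolding vj_rels_def by blast
  moreover have "set (X p q # map Rho ?r) \<subseteq> vj_letters n"
    "set (map Rho ?r @ [X (p + 1) (q + 1)]) \<subseteq> vj_letters n"
    using assms by auto
  ultimately have "word_value (VJ n) (vj_gen n) (pos_word (X p q # map Rho ?r)) =
      word_value (VJ n) (vj_gen n) (pos_word (map Rho ?r @ [X (p + 1) (q + 1)]))"
    by (rule vj_relation)
  also have "\<dots> = word_value (VJ n) (vj_gen n) (pos_word (map Rho ?r)) \<otimes>\<^bsub>VJ n\<^esub>
      word_value (VJ n) (vj_gen n) (pos_word [X (p + 1) (q + 1)])"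
    using assms R unfolding pos_word_def map_append
    by (intro word_value_append[of _ "vj_letters n"]) (auto simp: vj_gen_closed)
  finally have "vj_gen n (X p q) \<otimes>\<^bsub>VJ n\<^esub> iota_S n (apply_adj_transps ?r) =
      iota_S n (apply_adj_transps ?r) \<otimes>\<^bsub>VJ n\<^esub> vj_gen n (X (Suc p) (Suc q))"
    using assms hom_apply_adj_transps[OF group_VJ iota_S_hom iota_S_adj[symmetric] r]
    by (simp del: upt_Suc)
  then show ?thesis
    using assms shift_permutes[of 1 p q n] by (simp add: conj_by_eq_iff del: upt_Suc)
qed

text \<open>For \<open>p = 1\<close> this is the definition with the identity permutation.  The last defining relation says
  that conjugation by the shift takes \<open>x\<^bsub>p+1,q+1\<^esub>\<close> to \<open>x\<^sub>p\<^sub>,\<^sub>q\<close>, and the shift takes the tuple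
  \<open>(p + 1, \<dots>, q + 1)\<close> to \<open>(p, \<dots>, q)\<close>, so the claim moves up from \<open>p\<close> to \<open>p + 1\<close>.\<close>

lemma delta_interval:
  assumes "1 \<le> p" "p < q" "q \<le> n"
  shows "delta n (interval p q) = vj_gen n (X p q)"
  using assms
proof (induction p arbitrary: q rule: dec_induct)
  case base
  have "delta n (interval 1 q) = conj_by id (vj_gen n (X 1 (length (interval 1 q))))"
    using base by (intro delta_eq interval_tuples permutes_id) (auto simp del: upt_Suc)
  then show ?case using base by (simp add: conj_by_id del: upt_Suc)
next
  case (step p)
  obtain q' where q: "q = Suc q'" using step.prems by (cases q) auto
  have w: "shift p q' permutes {1..n}" using step q by (intro shift_permutes) auto
  have t: "interval (Suc p) q \<in> tuples n" using step by (intro interval_tuples) auto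
  have "conj_by (shift p q') (delta n (interval (Suc p) q)) = delta n (interval p q')"
    using conj_by_delta[OF w t] map_shift_interval[of p q'] step.prems q by (simp del: upt_Suc)
  also have "\<dots> = vj_gen n (X p q')" using step.prems q by (intro step.IH) auto
  also have "\<dots> = conj_by (shift p q') (vj_gen n (X (Suc p) q))"
    unfolding q using step.hyps step.prems q by (intro conj_by_shift[symmetric]) auto
  finally show ?case
    by (rule conj_by_inj[OF w delta_closed[OF t], rotated]) (use step in \<open>auto intro: vj_X_closed\<close>)
qed

lemma segment_eq_map_interval:
  assumes "\<forall>i\<in>{1..length y}. w i = y ! (i - 1)" "1 \<le> p" "q \<le> length y"
  shows "segment y p q = map w (interval p q)"
  using assms unfolding segment_def by auto

text \<open>One permutation moves a tuple and all its segments to intervals at once, which reduces relations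
  between the corresponding \<open>\<delta>\<close> to relations between the \<open>x\<^sub>p\<^sub>,\<^sub>q\<close>.\<close>

lemma delta_segment:
  assumes y: "y \<in> tuples n" and w: "w permutes {1..n}" "\<forall>i\<in>{1..length y}. w i = y ! (i - 1)"
    and pq: "1 \<le> p" "p < q" "q \<le> length y"
  shows "delta n (segment y p q) = conj_by w (vj_gen n (X p q))"
proof -
  have q: "q \<le> n" using y pq by (simp add: tuples_def)
  have "segment y p q = map w (interval p q)" using w pq by (intro segment_eq_map_interval) auto
  then show ?thesis
    using conj_by_delta[OF w(1) interval_tuples[OF pq(1,2) q]] delta_interval[OF pq(1,2) q] by simp
qed

lemma delta_square:
  assumes y: "y \<in> tuples n"
  shows "delta n y \<otimes>\<^bsub>VJ n\<^esub> delta n y = \<one>\<^bsub>VJ n\<^esub>"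
proof -
  obtain w where w: "w permutes {1..n}" "\<forall>i\<in>{1..length y}. w i = y ! (i - 1)"
    by (rule tuple_permutation[OF y]) blast
  have "vj_gen n (X 1 (length y)) \<in> carrier (VJ n)" using y by (simp add: tuples_def)
  from conj_by_mult[OF w(1) this this]
  have "delta n y \<otimes>\<^bsub>VJ n\<^esub> delta n y = conj_by w \<one>\<^bsub>VJ n\<^esub>"
    using y by (simp add: delta_eq[OF y w] vj_X_square tuples_def)
  also have "\<dots> = \<one>\<^bsub>VJ n\<^esub>" using w by (simp add: conj_by_def)
  finally show ?thesis .
qed

lemma delta_nested:
  assumes y: "y \<in> tuples n" and "tuple_le z y"
  shows "delta n (tuple_aut y z) \<otimes>\<^bsub>VJ n\<^esub> delta n y = delta n y \<otimes>\<^bsub>VJ n\<^esub> delta n z"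
proof -
  obtain p q where pq: "1 \<le> p" "p < q" "q \<le> length y" "z = segment y p q"
    using assms(2) by (rule tuple_leE)
  obtain w where w: "w permutes {1..n}" "\<forall>i\<in>{1..length y}. w i = y ! (i - 1)"
    by (rule tuple_permutation[OF y]) blast
  let ?l = "length y"
  have l: "?l \<le> n" "distinct y" using y by (auto simp: tuples_def)
  have "delta n (tuple_aut y z) = conj_by w (vj_gen n (X (1 + ?l - q) (1 + ?l - p)))"
    using delta_segment[OF y w, of "1 + ?l - q" "1 + ?l - p"] tuple_aut_segment[OF l(2) pq(1-3)] pq
    by simp
  moreover have "delta n z = conj_by w (vj_gen n (X p q))"
    unfolding pq(4) by (rule delta_segment[OF y w pq(1-3)])
  moreover have "vj_gen n (X 1 ?l) \<otimes>\<^bsub>VJ n\<^esub> vj_gen n (X p q) =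
      vj_gen n (X (1 + ?l - q) (1 + ?l - p)) \<otimes>\<^bsub>VJ n\<^esub> vj_gen n (X 1 ?l)"
    using pq l by (intro vj_X_nested) auto
  moreover have "vj_gen n (X (1 + ?l - q) (1 + ?l - p)) \<in> carrier (VJ n)"
    "vj_gen n (X p q) \<in> carrier (VJ n)" "vj_gen n (X 1 ?l) \<in> carrier (VJ n)"
    using pq l by (auto intro!: vj_X_closed)
  ultimately show ?thesis by (simp add: delta_eq[OF y w] conj_by_mult[OF w(1), symmetric])
qed

text \<open>Disjoint tuples are consecutive segments of their concatenation, which is again a tuple.\<close>

lemma delta_disjoint:
  assumes y: "y \<in> tuples n" and z: "z \<in> tuples n" and dis: "set y \<inter> set z = {}"
  shows "delta n y \<otimes>\<^bsub>VJ n\<^esub> delta n z = delta n z \<otimes>\<^bsub>VJ n\<^esub> delta n y"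
proof -
  let ?t = "y @ z" and ?l = "length y" and ?m = "length y + length z"
  have l: "2 \<le> length y" "2 \<le> length z" using y z by (auto simp: tuples_def)
  have d: "distinct ?t" "set ?t \<subseteq> {1..n}" using y z dis by (auto simp: tuples_def)
  then have m: "?m \<le> n"
    using card_mono[OF _ d(2)] distinct_card[OF d(1)] by simp
  then have t: "?t \<in> tuples n" using d l by (simp add: tuples_def)
  obtain w where w: "w permutes {1..n}" "\<forall>i\<in>{1..length ?t}. w i = ?t ! (i - 1)"
    by (rule tuple_permutation[OF t]) blast
  have "y = segment ?t 1 ?l" by (rule nth_equalityI) (auto simp: nth_append)
  moreover have "z = segment ?t (Suc ?l) ?m" by (rule nth_equalityI) (auto simp: nth_append)
  ultimately have "delta n y = conj_by w (vj_gen n (X 1 ?l))"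
    "delta n z = conj_by w (vj_gen n (X (Suc ?l) ?m))"
    using delta_segment[OF t w, of 1 ?l] delta_segment[OF t w, of "Suc ?l" ?m] l by auto
  moreover have "vj_gen n (X 1 ?l) \<otimes>\<^bsub>VJ n\<^esub> vj_gen n (X (Suc ?l) ?m) =
      vj_gen n (X (Suc ?l) ?m) \<otimes>\<^bsub>VJ n\<^esub> vj_gen n (X 1 ?l)"
    using l m by (intro vj_X_commute) auto
  moreover have "vj_gen n (X 1 ?l) \<in> carrier (VJ n)" "vj_gen n (X (Suc ?l) ?m) \<in> carrier (VJ n)"
    using l m by (auto intro!: vj_X_closed)
  ultimately show ?thesis by (simp add: conj_by_mult[OF w(1), symmetric])
qed

end

section \<open>Homomorphisms out of the trickle group and the virtual cactus group\<close>

text \<open>These are the defining relations of \<open>Tr(\<Gamma>)\<close> with the automorphisms \<open>\<phi>\<^sub>y\<close> evaluated.  At most one of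
  the two automorphisms in the relation of an edge moves anything: if the endpoints are comparable,
  the automorphism of the smaller one fixes the larger one, and if they are disjoint, both
  automorphisms act trivially.  The case \<open>z = y\<close> of the third clause is a triviality that saves a
  side condition.\<close>

definition tuple_family :: "('a, 'm) monoid_scheme \<Rightarrow> nat \<Rightarrow> (nat list \<Rightarrow> 'a) \<Rightarrow> bool" where
  "tuple_family H n f \<longleftrightarrow> f \<in> tuples n \<rightarrow> carrier H \<and>
    (\<forall>y\<in>tuples n. f y \<otimes>\<^bsub>H\<^esub> f y = \<one>\<^bsub>H\<^esub>) \<and>
    (\<forall>y\<in>tuples n. \<forall>z. tuple_le z y \<longrightarrow> f (tuple_aut y z) \<otimes>\<^bsub>H\<^esub> f y = f y \<otimes>\<^bsub>H\<^esub> f z) \<and>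
    (\<forall>y\<in>tuples n. \<forall>z\<in>tuples n. set y \<inter> set z = {} \<longrightarrow> f y \<otimes>\<^bsub>H\<^esub> f z = f z \<otimes>\<^bsub>H\<^esub> f y)"

lemma tuple_familyD:
  assumes "tuple_family H n f"
  shows "y \<in> tuples n \<Longrightarrow> f y \<in> carrier H"
    and "y \<in> tuples n \<Longrightarrow> f y \<otimes>\<^bsub>H\<^esub> f y = \<one>\<^bsub>H\<^esub>"
    and "y \<in> tuples n \<Longrightarrow> tuple_le z y \<Longrightarrow> f (tuple_aut y z) \<otimes>\<^bsub>H\<^esub> f y = f y \<otimes>\<^bsub>H\<^esub> f z"
    and "y \<in> tuples n \<Longrightarrow> z \<in> tuples n \<Longrightarrow> set y \<inter> set z = {} \<Longrightarrow> f y \<otimes>\<^bsub>H\<^esub> f z = f z \<otimes>\<^bsub>H\<^esub> f y"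
  using assms unfolding tuple_family_def by blast+

abbreviation Tr :: "nat \<Rightarrow> nat list word set monoid" where
  "Tr n \<equiv> trickle_group (Gam n)"

lemma group_Tr: "group (Tr n)"
  unfolding trickle_group_def by (rule group_presented_group)

lemma generate_trickle_gen: "generate (Tr n) (trickle_gen (Gam n) ` tuples n) = carrier (Tr n)"
  using generate_pres_gen[of "tuples n" "trickle_rels (Gam n)"]
  by (simp add: trickle_group_def trickle_gen_def)

lemma trickle_relation:
  assumes "(pos_word us, pos_word vs) \<in> trickle_rels (Gam n)" "set us \<subseteq> tuples n" "set vs \<subseteq> tuples n"
  shows "word_value (Tr n) (trickle_gen (Gam n)) (pos_word us) =
    word_value (Tr n) (trickle_gen (Gam n)) (pos_word vs)"
  using assms pres_gen_relation[of "pos_word us" "pos_word vs" "trickle_rels (Gam n)" "tuples n"]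
  by (simp add: trickle_group_def trickle_gen_def)

lemma tuple_aut_tuples:
  assumes "y \<in> tuples n" "tuple_le z y" shows "tuple_aut y z \<in> tuples n"
  using assms tuple_aut_le[of y z] tuple_le_tuples by (auto simp: tuples_def)

lemma disjoint_tuples_not_le:
  assumes "y \<in> tuples n" "z \<in> tuples n" "set y \<inter> set z = {}"
  shows "\<not> tuple_le y z" "y \<noteq> z"
proof -
  have "y ! 0 \<in> set y" using assms(1) by (intro nth_mem) (auto simp: tuples_def)
  then have "y ! 0 \<in> set y - set z" using assms(3) by auto
  then show "\<not> tuple_le y z" "y \<noteq> z" by (auto dest: tuple_le_set)
qed

lemma tuple_family_trickle_gen: "tuple_family (Tr n) n (trickle_gen (Gam n))"
proof -
  interpret group "Tr n" by (rule group_Tr)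
  let ?g = "trickle_gen (Gam n)"
  have closed: "?g y \<in> carrier (Tr n)" if "y \<in> tuples n" for y
    using that pres_gen_closed[of y "tuples n" "trickle_rels (Gam n)"]
    by (simp add: trickle_group_def trickle_gen_def)
  have edge: "?g (tuple_aut y z) \<otimes>\<^bsub>Tr n\<^esub> ?g y = ?g (tuple_aut z y) \<otimes>\<^bsub>Tr n\<^esub> ?g z"
    if "{y, z} \<in> edges (Gam n)" "tuple_aut y z \<in> tuples n" "tuple_aut z y \<in> tuples n" for y z
  proof -
    have yz: "y \<in> tuples n" "z \<in> tuples n" using that(1) by (auto simp: Gam_edges)
    have "(pos_word [tuple_aut y z, y], pos_word [tuple_aut z y, z]) \<in> trickle_rels (Gam n)"
      using that(1) unfolding trickle_rels_def by auto
    from trickle_relation[OF this] show ?thesis using that yz closed by simp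
  qed
  have square: "?g y \<otimes>\<^bsub>Tr n\<^esub> ?g y = \<one>\<^bsub>Tr n\<^esub>" if "y \<in> tuples n" for y
  proof -
    have "label (Gam n) y = enat 2" by (simp add: numeral_eq_enat)
    moreover have "y \<in> verts (Gam n)" using that by simp
    ultimately have "(pos_word (replicate 2 y), []) \<in> trickle_rels (Gam n)"
      unfolding trickle_rels_def by blast
    then have "(pos_word [y, y], pos_word []) \<in> trickle_rels (Gam n)"
      by (simp add: numeral_2_eq_2 pos_word_def)
    from trickle_relation[OF this] show ?thesis using that closed by simp
  qed
  have nested: "?g (tuple_aut y z) \<otimes>\<^bsub>Tr n\<^esub> ?g y = ?g y \<otimes>\<^bsub>Tr n\<^esub> ?g z"
    if y: "y \<in> tuples n" and le: "tuple_le z y" for y z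
  proof (cases "z = y")
    case True
    then show ?thesis using tuple_aut_self[of y] y by (simp add: tuples_def)
  next
    case False
    then have "tuple_aut z y = y" using tuple_le_antisym[OF le] by (intro tuple_aut_other) blast
    moreover have "{y, z} \<in> edges (Gam n)"
      using False y le tuple_le_tuples[OF le y] by (auto simp: Gam_edges)
    ultimately show ?thesis using edge[of y z] y tuple_aut_tuples[OF y le] by simp
  qed
  have disjoint: "?g y \<otimes>\<^bsub>Tr n\<^esub> ?g z = ?g z \<otimes>\<^bsub>Tr n\<^esub> ?g y"
    if "y \<in> tuples n" "z \<in> tuples n" "set y \<inter> set z = {}" for y z
  proof -
    have n: "\<not> tuple_le y z" "\<not> tuple_le z y" "y \<noteq> z"
      using disjoint_tuples_not_le[of y n z] disjoint_tuples_not_le[of z n y] that by auto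
    then have "{z, y} \<in> edges (Gam n)" using that by (auto simp: Gam_edges)
    from edge[OF this] show ?thesis using n that by (simp add: tuple_aut_other)
  qed
  show ?thesis
    unfolding tuple_family_def
    by (intro conjI ballI allI impI funcsetI) (simp_all only: closed square nested, rule disjoint)
qed

lemma tuple_family_hom_exists:
  assumes "group H" and f: "tuple_family H n f"
  shows "\<exists>h\<in>hom (Tr n) H. \<forall>y\<in>tuples n. h (trickle_gen (Gam n) y) = f y"
proof -
  interpret group H by fact
  note F = tuple_familyD[OF f]
  have edge: "f (tuple_aut y z) \<otimes>\<^bsub>H\<^esub> f y = f (tuple_aut z y) \<otimes>\<^bsub>H\<^esub> f z"
    if "{y, z} \<in> edges (Gam n)" for y z
  proof -
    have yz: "y \<in> tuples n" "z \<in> tuples n" "y \<noteq> z"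
      and "tuple_le y z \<or> tuple_le z y \<or> set y \<inter> set z = {}"
      using that by (auto simp: Gam_edges)
    then consider "tuple_le y z" "tuple_aut y z = z" | "tuple_le z y" "tuple_aut z y = y"
      | "set y \<inter> set z = {}" "tuple_aut y z = z" "tuple_aut z y = y"
      using tuple_aut_other tuple_le_antisym by metis
    then show ?thesis
    proof cases
      case 1
      then show ?thesis using F(3)[of z y] yz by simp
    next
      case 2
      then show ?thesis using F(3)[of y z] yz by simp
    next
      case 3
      then show ?thesis using F(4)[of z y] yz by (simp add: Int_commute)
    qed
  qed
  have "\<exists>h\<in>hom (presented_group (tuples n) (trickle_rels (Gam n))) H.
      \<forall>y\<in>tuples n. h (pres_gen (tuples n) (trickle_rels (Gam n)) y) = f y"
  proof (rule presented_group_hom_exists)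
    show "f \<in> tuples n \<rightarrow> carrier H" using F(1) by blast
    fix u v assume uv: "(u, v) \<in> trickle_rels (Gam n)" "u \<in> words (tuples n)" "v \<in> words (tuples n)"
    then consider y m where "u = pos_word (replicate m y)" "v = []" "y \<in> tuples n" "(2::enat) = enat m"
      | y z where "u = pos_word [tuple_aut y z, y]" "v = pos_word [tuple_aut z y, z]"
        "{y, z} \<in> edges (Gam n)"
      unfolding trickle_rels_def by auto
    then show "word_value H f u = word_value H f v"
    proof cases
      case 1
      then have "m = 2" by (simp add: numeral_eq_enat)
      then show ?thesis using 1 F(1,2)[of y] by (simp add: numeral_2_eq_2)
    next
      case 2
      then have "f y \<in> carrier H" "f z \<in> carrier H" using F(1) by (auto simp: Gam_edges)
      then show ?thesis using 2 edge[of y z] by simp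
    qed
  qed
  then show ?thesis by (simp add: trickle_group_def trickle_gen_def)
qed

text \<open>Giving the images of the \<open>\<rho>\<^sub>i\<close> through a homomorphism \<open>j\<close> on the symmetric group absorbs the Coxeter
  relations, and the last defining relation then speaks of a single permutation.\<close>

lemma VJ_hom_exists:
  assumes "group H" and j: "j \<in> hom (sym_group n) H"
    and closed: "\<And>p q. \<lbrakk>1 \<le> p; p < q; q \<le> n\<rbrakk> \<Longrightarrow> x p q \<in> carrier H"
    and square: "\<And>p q. \<lbrakk>1 \<le> p; p < q; q \<le> n\<rbrakk> \<Longrightarrow> x p q \<otimes>\<^bsub>H\<^esub> x p q = \<one>\<^bsub>H\<^esub>"
    and disjoint: "\<And>p q m r. \<lbrakk>1 \<le> p; p < q; q \<le> n; 1 \<le> m; m < r; r \<le> n; {p..q} \<inter> {m..r} = {}\<rbrakk> \<Longrightarrow>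
      x p q \<otimes>\<^bsub>H\<^esub> x m r = x m r \<otimes>\<^bsub>H\<^esub> x p q"
    and nested: "\<And>p q m r. \<lbrakk>1 \<le> p; p \<le> m; m < r; r \<le> q; q \<le> n\<rbrakk> \<Longrightarrow>
      x p q \<otimes>\<^bsub>H\<^esub> x m r = x (p + q - r) (p + q - m) \<otimes>\<^bsub>H\<^esub> x p q"
    and far: "\<And>i p q. \<lbrakk>1 \<le> i; i < n; 1 \<le> p; p < q; q \<le> n; i < p - 1 \<or> q < i\<rbrakk> \<Longrightarrow>
      j (adj i) \<otimes>\<^bsub>H\<^esub> x p q = x p q \<otimes>\<^bsub>H\<^esub> j (adj i)"
    and shift: "\<And>p q. \<lbrakk>1 \<le> p; p < q; q < n\<rbrakk> \<Longrightarrow>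
      x p q \<otimes>\<^bsub>H\<^esub> j (shift p q) = j (shift p q) \<otimes>\<^bsub>H\<^esub> x (Suc p) (Suc q)"
  shows "\<exists>h\<in>hom (VJ n) H. (\<forall>p q. 1 \<le> p \<and> p < q \<and> q \<le> n \<longrightarrow> h (vj_gen n (X p q)) = x p q) \<and>
    (\<forall>i. 1 \<le> i \<and> i < n \<longrightarrow> h (vj_gen n (Rho i)) = j (adj i))"
proof -
  interpret H: group H by fact
  interpret j: group_hom "sym_group n" H j
    using j assms(1) sym_group_is_group by (simp add: group_hom_def group_hom_axioms_def)
  define f where "f l = (case l of X p q \<Rightarrow> x p q | Rho i \<Rightarrow> j (adj i))" for l
  have f [simp]: "f (X p q) = x p q" "f (Rho i) = j (adj i)" for p q i
    by (simp_all add: f_def)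
  have j_closed [simp]: "j (adj i) \<in> carrier H" if "1 \<le> i" "i < n" for i
    using that adj_permutes[of 1 i n] by (simp add: sym_group_carrier)
  have f_closed: "f \<in> vj_letters n \<rightarrow> carrier H"
    using closed by (auto simp: vj_letters_def)
  have j_comp: "j v \<otimes>\<^bsub>H\<^esub> j w = j (v \<circ> w)" if "v permutes {1..n}" "w permutes {1..n}" for v w
    using j.hom_mult[of v w] that by (simp only: sym_group_carrier sym_group_mult)
  have "\<exists>h\<in>hom (presented_group (vj_letters n) (vj_rels n)) H.
      \<forall>l\<in>vj_letters n. h (pres_gen (vj_letters n) (vj_rels n) l) = f l"
  proof (rule H.presented_group_hom_exists[OF f_closed])
    fix u v assume uv: "(u, v) \<in> vj_rels n" and w: "u \<in> words (vj_letters n)" "v \<in> words (vj_letters n)"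
    show "word_value H f u = word_value H f v"
      using uv unfolding vj_rels_def
    proof (elim UnE CollectE exE conjE)
      fix p q assume "(u, v) = (pos_word [X p q, X p q], [])" and "1 \<le> p" "p < q" "q \<le> n"
      then show ?thesis using closed square by simp
    next
      fix p q m r assume "(u, v) = (pos_word [X p q, X m r], pos_word [X m r, X p q])"
        and *: "1 \<le> p" "p < q" "q \<le> n" "1 \<le> m" "m < r" "r \<le> n" "{p..q} \<inter> {m..r} = {}"
      then show ?thesis using closed disjoint[OF *] by simp
    next
      fix p q m r assume uv: "(u, v) = (pos_word [X p q, X m r], pos_word [X (p + q - r) (p + q - m), X p q])"
        and *: "1 \<le> p" "p < q" "q \<le> n" "1 \<le> m" "m < r" "r \<le> n" "{m..r} \<subseteq> {p..q}"
      then have **: "p \<le> m" "r \<le> q" by auto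
      then have "x (p + q - r) (p + q - m) \<in> carrier H" using * by (intro closed) auto
      then show ?thesis using uv closed * ** nested[of p m r q] by simp
    next
      fix i assume "(u, v) = (pos_word [Rho i, Rho i], [])" and "1 \<le> i" "i \<le> n - 1"
      then show ?thesis
        using j_comp[of "adj i" "adj i"] adj_permutes[of 1 i n] j.hom_one
        by (simp add: sym_group_def)
    next
      fix i k assume uv: "(u, v) = (pos_word [Rho i, Rho k, Rho i], pos_word [Rho k, Rho i, Rho k])"
        and *: "1 \<le> i" "i \<le> n - 1" "1 \<le> k" "k \<le> n - 1" "\<bar>int i - int k\<bar> = 1"
      then have "adj i \<circ> (adj k \<circ> adj i) = adj k \<circ> (adj i \<circ> adj k)"
        by (auto simp: fun_eq_iff transpose_def)
      then show ?thesis
        using uv * j_comp[of "adj i" "adj k \<circ> adj i"] j_comp[of "adj k" "adj i \<circ> adj k"]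
          j_comp[of "adj i" "adj k"] j_comp[of "adj k" "adj i"] adj_permutes[of 1 _ n]
        by (simp add: permutes_compose)
    next
      fix i k assume uv: "(u, v) = (pos_word [Rho i, Rho k], pos_word [Rho k, Rho i])"
        and *: "1 \<le> i" "i \<le> n - 1" "1 \<le> k" "k \<le> n - 1" "\<bar>int i - int k\<bar> > 1"
      then have "adj i \<circ> adj k = adj k \<circ> adj i"
        by (auto simp: fun_eq_iff transpose_def)
      then show ?thesis
        using uv * j_comp[of "adj i" "adj k"] j_comp[of "adj k" "adj i"] adj_permutes[of 1 _ n]
        by simp
    next
      fix i p q assume uv: "(u, v) = (pos_word [Rho i, X p q], pos_word [X p q, Rho i])"
        and *: "1 \<le> i" "i \<le> n - 1" "1 \<le> p" "p < q" "q \<le> n" "i < p - 1 \<or> i \<ge> q + 1"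
      then show ?thesis using closed far[of i p q] by auto
    next
      fix p q assume uv: "(u, v) = (pos_word (X p q # map Rho (rev [p..<q + 1])),
          pos_word (map Rho (rev [p..<q + 1]) @ [X (p + 1) (q + 1)]))"
        and *: "1 \<le> p" "p < q" "q < n"
      have "word_value H f (pos_word (map Rho (rev [p..<Suc q]))) = j (shift p q)"
        using * by (intro hom_apply_adj_transps[OF assms(1) j]) auto
      moreover have "word_value H f v = word_value H f (pos_word (map Rho (rev [p..<Suc q]))) \<otimes>\<^bsub>H\<^esub>
          word_value H f (pos_word [X (Suc p) (Suc q)])"
        using uv w(2) H.word_value_append[OF f_closed, of "pos_word (map Rho (rev [p..<Suc q]))"
            "pos_word [X (Suc p) (Suc q)]"]
        by (simp add: pos_word_def del: upt_Suc)
      ultimately show ?thesis using uv * closed[of "Suc p" "Suc q"] shift[OF *]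
        by (simp del: upt_Suc)
    qed
  qed
  then obtain h where "h \<in> hom (VJ n) H" and h: "\<And>l. l \<in> vj_letters n \<Longrightarrow> h (vj_gen n l) = f l"
    unfolding VJ_def vj_gen_def by blast
  then show ?thesis by (intro bexI[of _ h]) (simp_all add: h)
qed

section \<open>Semidirect products\<close>

definition semidirect :: "('a, 'm) monoid_scheme \<Rightarrow> ('b, 'k) monoid_scheme \<Rightarrow> ('b \<Rightarrow> 'a \<Rightarrow> 'a) \<Rightarrow>
    ('a \<times> 'b) monoid" where
  "semidirect A B \<alpha> = \<lparr>carrier = carrier A \<times> carrier B,
     mult = \<lambda>(a, v) (b, w). (a \<otimes>\<^bsub>A\<^esub> \<alpha> v b, v \<otimes>\<^bsub>B\<^esub> w),
     one = (\<one>\<^bsub>A\<^esub>, \<one>\<^bsub>B\<^esub>)\<rparr>"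

lemma semidirect_simps [simp]:
  "(a, v) \<in> carrier (semidirect A B \<alpha>) \<longleftrightarrow> a \<in> carrier A \<and> v \<in> carrier B"
  "(a, v) \<otimes>\<^bsub>semidirect A B \<alpha>\<^esub> (b, w) = (a \<otimes>\<^bsub>A\<^esub> \<alpha> v b, v \<otimes>\<^bsub>B\<^esub> w)"
  "\<one>\<^bsub>semidirect A B \<alpha>\<^esub> = (\<one>\<^bsub>A\<^esub>, \<one>\<^bsub>B\<^esub>)"
  by (simp_all add: semidirect_def)

locale group_automorphism_action = A: group A + B: group B for A :: "('a, 'm) monoid_scheme" (structure) and B :: "('b, 'k) monoid_scheme" (structure) +
  fixes \<alpha> :: "'b \<Rightarrow> 'a \<Rightarrow> 'a"
  assumes hom: "v \<in> carrier B \<Longrightarrow> \<alpha> v \<in> hom A A"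
    and comp: "\<lbrakk>v \<in> carrier B; w \<in> carrier B; a \<in> carrier A\<rbrakk> \<Longrightarrow> \<alpha> (v \<otimes>\<^bsub>B\<^esub> w) a = \<alpha> v (\<alpha> w a)"
    and one: "a \<in> carrier A \<Longrightarrow> \<alpha> \<one>\<^bsub>B\<^esub> a = a"
begin

abbreviation AB where "AB \<equiv> semidirect A B \<alpha>"

lemma act_closed [simp]: "v \<in> carrier B \<Longrightarrow> a \<in> carrier A \<Longrightarrow> \<alpha> v a \<in> carrier A"
  using hom by (rule hom_in_carrier)

lemma act_mult: "\<lbrakk>v \<in> carrier B; a \<in> carrier A; b \<in> carrier A\<rbrakk> \<Longrightarrow>
    \<alpha> v (a \<otimes>\<^bsub>A\<^esub> b) = \<alpha> v a \<otimes>\<^bsub>A\<^esub> \<alpha> v b"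
  using hom by (rule hom_mult)

lemma act_one [simp]: "v \<in> carrier B \<Longrightarrow> \<alpha> v \<one>\<^bsub>A\<^esub> = \<one>\<^bsub>A\<^esub>"
  using hom_one[OF hom A.is_group A.is_group] .

lemma group_semidirect: "group AB"
proof (rule groupI)
  fix x y assume "x \<in> carrier AB" "y \<in> carrier AB"
  then show "x \<otimes>\<^bsub>AB\<^esub> y \<in> carrier AB" by (cases x; cases y) simp
next
  show "\<one>\<^bsub>AB\<^esub> \<in> carrier AB" by simp
next
  fix x y z assume "x \<in> carrier AB" "y \<in> carrier AB" "z \<in> carrier AB"
  then show "x \<otimes>\<^bsub>AB\<^esub> y \<otimes>\<^bsub>AB\<^esub> z = x \<otimes>\<^bsub>AB\<^esub> (y \<otimes>\<^bsub>AB\<^esub> z)"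
    by (cases x; cases y; cases z) (simp add: act_mult comp A.m_assoc B.m_assoc)
next
  fix x assume "x \<in> carrier AB"
  then show "\<one>\<^bsub>AB\<^esub> \<otimes>\<^bsub>AB\<^esub> x = x" by (cases x) (simp add: one)
next
  fix x assume x: "x \<in> carrier AB"
  obtain a v where [simp]: "x = (a, v)" by (cases x)
  let ?v = "inv\<^bsub>B\<^esub> v"
  have "\<alpha> ?v (inv\<^bsub>A\<^esub> a) \<otimes>\<^bsub>A\<^esub> \<alpha> ?v a = \<one>\<^bsub>A\<^esub>"
    using x by (simp add: act_mult[symmetric])
  then show "\<exists>y\<in>carrier AB. y \<otimes>\<^bsub>AB\<^esub> x = \<one>\<^bsub>AB\<^esub>"
    using x by (intro bexI[of _ "(\<alpha> ?v (inv\<^bsub>A\<^esub> a), ?v)"]) simp_all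
qed

lemma semidirect_fst_hom: "(\<lambda>a. (a, \<one>\<^bsub>B\<^esub>)) \<in> hom A AB"
  by (rule homI) (simp_all add: one)

lemma semidirect_snd_hom: "(\<lambda>v. (\<one>\<^bsub>A\<^esub>, v)) \<in> hom B AB"
  by (rule homI) simp_all

lemma semidirect_proj_hom: "snd \<in> hom AB B"
  by (rule homI) auto

text \<open>The equivariance condition is what moves \<open>g v\<close> past \<open>f b\<close> in a product of two values.\<close>

lemma semidirect_hom:
  assumes "group H" and f: "f \<in> hom A H" and g: "g \<in> hom B H"
    and equivariant: "\<And>a v. \<lbrakk>a \<in> carrier A; v \<in> carrier B\<rbrakk> \<Longrightarrow>
      g v \<otimes>\<^bsub>H\<^esub> f a = f (\<alpha> v a) \<otimes>\<^bsub>H\<^esub> g v"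
  shows "(\<lambda>(a, v). f a \<otimes>\<^bsub>H\<^esub> g v) \<in> hom AB H"
proof (rule homI)
  interpret H: group H by fact
  note closed [simp] = hom_in_carrier[OF f] hom_in_carrier[OF g]
  fix x assume x: "x \<in> carrier AB"
  then show "(case x of (a, v) \<Rightarrow> f a \<otimes>\<^bsub>H\<^esub> g v) \<in> carrier H" by (cases x) simp
  fix y assume y: "y \<in> carrier AB"
  obtain a v b w where [simp]: "x = (a, v)" "y = (b, w)" by (cases x; cases y)
  have c: "a \<in> carrier A" "v \<in> carrier B" "b \<in> carrier A" "w \<in> carrier B" using x y by auto
  have "f (a \<otimes>\<^bsub>A\<^esub> \<alpha> v b) \<otimes>\<^bsub>H\<^esub> g (v \<otimes>\<^bsub>B\<^esub> w) =
      f a \<otimes>\<^bsub>H\<^esub> (f (\<alpha> v b) \<otimes>\<^bsub>H\<^esub> g v) \<otimes>\<^bsub>H\<^esub> g w"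
    using c by (simp add: hom_mult[OF f] hom_mult[OF g] H.m_assoc)
  also have "\<dots> = f a \<otimes>\<^bsub>H\<^esub> g v \<otimes>\<^bsub>H\<^esub> (f b \<otimes>\<^bsub>H\<^esub> g w)"
    using c by (simp add: equivariant[symmetric] H.m_assoc)
  finally show "(case x \<otimes>\<^bsub>AB\<^esub> y of (a, v) \<Rightarrow> f a \<otimes>\<^bsub>H\<^esub> g v) =
      (case x of (a, v) \<Rightarrow> f a \<otimes>\<^bsub>H\<^esub> g v) \<otimes>\<^bsub>H\<^esub> (case y of (a, v) \<Rightarrow> f a \<otimes>\<^bsub>H\<^esub> g v)"
    by simp
qed

end

section \<open>The symmetric group acting on the trickle group\<close>

lemma segment_map: "1 \<le> p \<Longrightarrow> q \<le> length y \<Longrightarrow> segment (map v y) p q = map v (segment y p q)"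
  by (auto simp: segment_def)

lemma tuple_le_map: "tuple_le z y \<Longrightarrow> tuple_le (map v z) (map v y)"
  by (metis length_map segment_map tuple_le_def)

lemma tuple_aut_map:
  assumes "distinct y" "inj_on v (set y)" "tuple_le z y"
  shows "tuple_aut (map v y) (map v z) = map v (tuple_aut y z)"
proof -
  obtain p q where pq: "1 \<le> p" "p < q" "q \<le> length y" "z = segment y p q"
    using assms(3) by (rule tuple_leE)
  have "distinct (map v y)" using assms by (simp add: distinct_map)
  then have "tuple_aut (map v y) (segment (map v y) p q) =
      segment (map v y) (1 + length y - q) (1 + length y - p)"
    using tuple_aut_segment[of "map v y" p q] pq by simp
  then show ?thesis using pq assms(1) by (simp add: segment_map tuple_aut_segment)
qed

lemma segment_interval:
  assumes "1 \<le> a" "a \<le> b" "b \<le> Suc q - p"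
  shows "segment (interval p q) a b = interval (p + a - 1) (p + b - 1)"
  using assms by (intro nth_equalityI) (auto simp del: upt_Suc)

text \<open>The graph, its order and its automorphisms are invariant under renaming the entries of all tuples,
  so a permutation takes the relations of \<open>Tr(\<Gamma>)\<close> to relations.\<close>

lemma tuple_family_map:
  assumes v: "v permutes {1..n}" and f: "tuple_family H n f"
  shows "tuple_family H n (\<lambda>y. f (map v y))"
proof -
  note F = tuple_familyD[OF f]
  have t: "map v y \<in> tuples n" if "y \<in> tuples n" for y
    using v that by (rule map_permutation_tuples)
  have aut: "map v (tuple_aut y z) = tuple_aut (map v y) (map v z)"
    if "y \<in> tuples n" "tuple_le z y" for y z
    using that permutes_inj_on[OF v] by (intro tuple_aut_map[symmetric]) (auto simp: tuples_def)
  have disjoint: "set (map v y) \<inter> set (map v z) = {}" if "set y \<inter> set z = {}" for y z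
    using that permutes_inj[OF v] by (auto dest: injD)
  show ?thesis
    unfolding tuple_family_def
    by (intro conjI ballI allI impI funcsetI)
      (auto simp only: aut intro!: F t tuple_le_map disjoint)
qed

context
  fixes n :: nat
begin

definition tr_act :: "(nat \<Rightarrow> nat) \<Rightarrow> nat list word set \<Rightarrow> nat list word set" where
  "tr_act v = the_hom (Tr n) (Tr n) (tuples n) (trickle_gen (Gam n)) (\<lambda>y. trickle_gen (Gam n) (map v y))"

lemma tr_act_hom: "v permutes {1..n} \<Longrightarrow> tr_act v \<in> hom (Tr n) (Tr n)"
  and tr_act_gen: "\<lbrakk>v permutes {1..n}; y \<in> tuples n\<rbrakk> \<Longrightarrow>
    tr_act v (trickle_gen (Gam n) y) = trickle_gen (Gam n) (map v y)"
proof -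
  assume v: "v permutes {1..n}"
  note ex = tuple_family_hom_exists[OF group_Tr tuple_family_map[OF v tuple_family_trickle_gen]]
  note the = group.the_hom_on_generated[OF group_Tr generate_trickle_gen group_Tr ex]
  show "tr_act v \<in> hom (Tr n) (Tr n)" unfolding tr_act_def by (rule the(1))
  show "tr_act v (trickle_gen (Gam n) y) = trickle_gen (Gam n) (map v y)" if "y \<in> tuples n"
    unfolding tr_act_def using that by (rule the(2))
qed

lemma Tr_hom_eq:
  assumes "group H" "h \<in> hom (Tr n) H" "h' \<in> hom (Tr n) H"
    "\<And>y. y \<in> tuples n \<Longrightarrow> h (trickle_gen (Gam n) y) = h' (trickle_gen (Gam n) y)" "a \<in> carrier (Tr n)"
  shows "h a = h' a"
  using group.hom_eq_on_generators[OF group_Tr generate_trickle_gen assms(1-3) _ assms(5)] assms(4)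
  by blast

lemma trickle_gen_closed: "y \<in> tuples n \<Longrightarrow> trickle_gen (Gam n) y \<in> carrier (Tr n)"
  by (rule tuple_familyD[OF tuple_family_trickle_gen])

lemma tr_action: "group_automorphism_action (Tr n) (sym_group n) tr_act"
proof -
  interpret group "Tr n" by (rule group_Tr)
  have comp: "tr_act (v \<circ> w) a = tr_act v (tr_act w a)"
    if vw: "v permutes {1..n}" "w permutes {1..n}" and a: "a \<in> carrier (Tr n)" for v w a
  proof -
    have "tr_act (v \<circ> w) a = (tr_act v \<circ> tr_act w) a"
    proof (rule Tr_hom_eq[OF group_Tr _ _ _ a])
      show "tr_act (v \<circ> w) \<in> hom (Tr n) (Tr n)" using vw by (intro tr_act_hom permutes_compose)
      show "tr_act v \<circ> tr_act w \<in> hom (Tr n) (Tr n)"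
        by (rule Group.hom_compose[OF tr_act_hom[OF vw(2)] tr_act_hom[OF vw(1)]])
      fix y assume y: "y \<in> tuples n"
      show "tr_act (v \<circ> w) (trickle_gen (Gam n) y) = (tr_act v \<circ> tr_act w) (trickle_gen (Gam n) y)"
        using y map_permutation_tuples[OF vw(2) y] permutes_compose[OF vw(2,1)] vw
        by (simp add: tr_act_gen)
    qed
    then show ?thesis by simp
  qed
  have one: "tr_act id a = a" if a: "a \<in> carrier (Tr n)" for a
  proof -
    have "tr_act id a = id a"
    proof (rule Tr_hom_eq[OF group_Tr _ _ _ a])
      show "tr_act id \<in> hom (Tr n) (Tr n)" by (intro tr_act_hom permutes_id)
      show "id \<in> hom (Tr n) (Tr n)" by (simp add: hom_def)
      show "tr_act id (trickle_gen (Gam n) y) = id (trickle_gen (Gam n) y)" if "y \<in> tuples n" for y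
        using tr_act_gen[OF permutes_id that] by simp
    qed
    then show ?thesis by simp
  qed
  show ?thesis
  proof (rule group_automorphism_action.intro[OF group_Tr sym_group_is_group])
    show "group_automorphism_action_axioms (Tr n) (sym_group n) tr_act"
      by unfold_locales
        (simp_all only: sym_group_carrier sym_group_mult sym_group_one tr_act_hom comp one)
  qed
qed

interpretation action: group_automorphism_action "Tr n" "sym_group n" tr_act
  by (rule tr_action)

section \<open>The isomorphism\<close>

text \<open>The homomorphism \<open>\<Psi>\<close>.  Products in the semidirect product of an element with trivial permutation
  part and one with trivial trickle part are computed once, after which each relation of the virtual
  cactus group is either a trickle relation between intervals or says where a permutation sends an
  interval.\<close>

lemma vj_to_semidirect_exists:
  "\<exists>\<Psi>\<in>hom (VJ n) action.AB.
    (\<forall>p q. 1 \<le> p \<and> p < q \<and> q \<le> n \<longrightarrow> \<Psi> (vj_gen n (X p q)) = (trickle_gen (Gam n) (interval p q), id)) \<and>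
    (\<forall>i. 1 \<le> i \<and> i < n \<longrightarrow> \<Psi> (vj_gen n (Rho i)) = (\<one>\<^bsub>Tr n\<^esub>, adj i))"
proof -
  let ?g = "trickle_gen (Gam n)" and ?x = "\<lambda>p q. (trickle_gen (Gam n) (interval p q), id)"
  note G = tuple_familyD[OF tuple_family_trickle_gen[of n]]
  have id_act: "tr_act id a = a" if "a \<in> carrier (Tr n)" for a
    using action.one[OF that] by (simp only: sym_group_one)
  have closed: "?g (interval p q) \<in> carrier (Tr n)" if "1 \<le> p" "p < q" "q \<le> n" for p q
    using that by (intro trickle_gen_closed interval_tuples)
  have xx: "?x p q \<otimes>\<^bsub>action.AB\<^esub> ?x m r = (?g (interval p q) \<otimes>\<^bsub>Tr n\<^esub> ?g (interval m r), id)"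
    if "1 \<le> m" "m < r" "r \<le> n" for p q m r
    unfolding semidirect_simps sym_group_mult id_act[OF closed[OF that]] by simp
  have jx: "(\<one>\<^bsub>Tr n\<^esub>, w) \<otimes>\<^bsub>action.AB\<^esub> ?x p q = (?g (map w (interval p q)), w)"
    if "1 \<le> p" "p < q" "q \<le> n" "w permutes {1..n}" for p q w
    unfolding semidirect_simps sym_group_mult tr_act_gen[OF that(4) interval_tuples[OF that(1-3)]]
    using trickle_gen_closed[OF map_permutation_tuples[OF that(4) interval_tuples[OF that(1-3)]]] by simp
  have xj: "?x p q \<otimes>\<^bsub>action.AB\<^esub> (\<one>\<^bsub>Tr n\<^esub>, w) = (?g (interval p q), w)"
    if "1 \<le> p" "p < q" "q \<le> n" for p q w
    unfolding semidirect_simps sym_group_mult id_act[OF action.A.one_closed]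
    using closed[OF that] by simp
  show ?thesis
  proof (rule VJ_hom_exists[OF action.group_semidirect action.semidirect_snd_hom])
    fix p q assume *: "1 \<le> p" "p < q" "q \<le> n"
    then show "?x p q \<in> carrier action.AB" using closed by (simp add: sym_group_carrier permutes_id)
    show "?x p q \<otimes>\<^bsub>action.AB\<^esub> ?x p q = \<one>\<^bsub>action.AB\<^esub>"
      unfolding xx[OF *] G(2)[OF interval_tuples[OF *]] by (simp add: sym_group_one)
  next
    fix p q m r assume p: "1 \<le> p" "p < q" "q \<le> n" and m: "1 \<le> m" "m < r" "r \<le> n"
      and dis: "{p..q} \<inter> {m..r} = {}"
    have "set (interval p q) \<inter> set (interval m r) = {}"
      using dis by (simp add: atLeastLessThanSuc_atLeastAtMost del: upt_Suc)
    then show "?x p q \<otimes>\<^bsub>action.AB\<^esub> ?x m r = ?x m r \<otimes>\<^bsub>action.AB\<^esub> ?x p q"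
      unfolding xx[OF p] xx[OF m] using G(4) interval_tuples[OF p] interval_tuples[OF m] by blast
  next
    fix p q m r assume *: "1 \<le> p" "p \<le> m" "m < r" "r \<le> q" "q \<le> n"
    then have p: "1 \<le> p" "p < q" "q \<le> n" and m: "1 \<le> m" "m < r" "r \<le> n" by auto
    \<comment> \<open>The positions of \<open>m\<close> and \<open>r\<close> in the tuple \<open>(p, \<dots>, q)\<close>, counted from 1.\<close>
    let ?a = "m - p + 1" and ?b = "r - p + 1" and ?y = "interval p q" and ?l = "q - p + 1"
    have l: "length ?y = ?l" using * by auto
    have ab: "1 \<le> ?a" "?a < ?b" "?b \<le> length ?y" unfolding l using * by auto
    have z: "interval m r = segment ?y ?a ?b"
      using * by (subst segment_interval) auto
    have "tuple_aut ?y (interval m r) = segment ?y (1 + ?l - ?b) (1 + ?l - ?a)"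
      using tuple_aut_segment[OF distinct_upt ab] unfolding l z .
    also have "\<dots> = interval (p + q - r) (p + q - m)"
      using * by (subst segment_interval) auto
    finally have "?g (interval (p + q - r) (p + q - m)) \<otimes>\<^bsub>Tr n\<^esub> ?g ?y = ?g ?y \<otimes>\<^bsub>Tr n\<^esub> ?g (interval m r)"
      using G(3)[OF interval_tuples[OF p] tuple_le_segment[OF ab]] unfolding z by simp
    then show "?x p q \<otimes>\<^bsub>action.AB\<^esub> ?x m r = ?x (p + q - r) (p + q - m) \<otimes>\<^bsub>action.AB\<^esub> ?x p q"
      unfolding xx[OF p] xx[OF m] by simp
  next
    fix i p q assume i: "1 \<le> i" "i < n" and p: "1 \<le> p" "p < q" "q \<le> n" and far: "i < p - 1 \<or> q < i"
    have "map (adj i) (interval p q) = interval p q"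
      using far by (intro map_idI) (auto simp: transpose_def)
    then show "(\<one>\<^bsub>Tr n\<^esub>, adj i) \<otimes>\<^bsub>action.AB\<^esub> ?x p q = ?x p q \<otimes>\<^bsub>action.AB\<^esub> (\<one>\<^bsub>Tr n\<^esub>, adj i)"
      unfolding xj[OF p] jx[OF p adj_permutes[OF i]] by simp
  next
    fix p q assume p: "1 \<le> p" "p < q" "q < n"
    then have p': "1 \<le> p" "p < q" "q \<le> n" "1 \<le> Suc p" "Suc p < Suc q" "Suc q \<le> n" by auto
    show "?x p q \<otimes>\<^bsub>action.AB\<^esub> (\<one>\<^bsub>Tr n\<^esub>, shift p q) =
        (\<one>\<^bsub>Tr n\<^esub>, shift p q) \<otimes>\<^bsub>action.AB\<^esub> ?x (Suc p) (Suc q)"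
      unfolding xj[OF p'(1-3)] jx[OF p'(4-6) shift_permutes[OF p(1,3)]]
        map_shift_interval[OF less_imp_le[OF p(2)]] ..
  qed
qed

lemma trickle_to_vj_exists:
  "\<exists>\<phi>\<in>hom (Tr n) (VJ n). \<forall>y\<in>tuples n. \<phi> (trickle_gen (Gam n) y) = delta n y"
proof (rule tuple_family_hom_exists[OF group_VJ])
  show "tuple_family (VJ n) n (delta n)"
    unfolding tuple_family_def
    by (intro conjI ballI allI impI funcsetI)
      (simp_all only: delta_closed delta_square delta_nested, rule delta_disjoint)
qed

end

theorem proposition3p7:
  fixes n :: nat
  assumes "n \<ge> 2"
  shows "(\<forall>y\<in>tuples n. Phi n (trickle_gen (Gam n) y) = delta n y) \<and>
    Phi n \<in> iso (trickle_group (Gam n)) (KVJ n)"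
proof -
  let ?g = "trickle_gen (Gam n)" and ?S = "sym_group n"
  interpret V: group "VJ n" by (rule group_VJ)
  interpret S: group ?S by (rule sym_group_is_group)
  interpret T: group "Tr n" by (rule group_Tr)
  interpret action: group_automorphism_action "Tr n" ?S "tr_act n" by (rule tr_action)
  interpret P: group action.AB by (rule action.group_semidirect)
  obtain \<Psi> where \<Psi>: "\<Psi> \<in> hom (VJ n) action.AB"
    and \<Psi>_all: "\<forall>p q. 1 \<le> p \<and> p < q \<and> q \<le> n \<longrightarrow> \<Psi> (vj_gen n (X p q)) = (?g (interval p q), id)"
      "\<forall>i. 1 \<le> i \<and> i < n \<longrightarrow> \<Psi> (vj_gen n (Rho i)) = (\<one>\<^bsub>Tr n\<^esub>, adj i)"
    using vj_to_semidirect_exists[of n] by (elim bexE conjE) (rule that)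
  have \<Psi>_X: "\<Psi> (vj_gen n (X p q)) = (?g (interval p q), id)" if "1 \<le> p" "p < q" "q \<le> n" for p q
    using \<Psi>_all(1) that by (simp only:)
  have \<Psi>_Rho: "\<Psi> (vj_gen n (Rho i)) = (\<one>\<^bsub>Tr n\<^esub>, adj i)" if "1 \<le> i" "i < n" for i
    using \<Psi>_all(2) that by (simp only:)
  obtain \<phi> where \<phi>: "\<phi> \<in> hom (Tr n) (VJ n)" and \<phi>_gen: "\<And>y. y \<in> tuples n \<Longrightarrow> \<phi> (?g y) = delta n y"
    using trickle_to_vj_exists[of n] by (elim bexE) (rule that, assumption, erule bspec)
  have equivariant: "iota_S n v \<otimes>\<^bsub>VJ n\<^esub> \<phi> a = \<phi> (tr_act n v a) \<otimes>\<^bsub>VJ n\<^esub> iota_S n v"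
    if a: "a \<in> carrier (Tr n)" and "v \<in> carrier ?S" for a v
  proof -
    have v: "v permutes {1..n}" using that(2) by (simp add: sym_group_carrier)
    have "(conj_by n v \<circ> \<phi>) a = (\<phi> \<circ> tr_act n v) a"
    proof (rule Tr_hom_eq[OF group_VJ _ _ _ a])
      show "conj_by n v \<circ> \<phi> \<in> hom (Tr n) (VJ n)" by (rule Group.hom_compose[OF \<phi> conj_by_hom[OF v]])
      show "\<phi> \<circ> tr_act n v \<in> hom (Tr n) (VJ n)" by (rule Group.hom_compose[OF tr_act_hom[OF v] \<phi>])
      show "(conj_by n v \<circ> \<phi>) (?g y) = (\<phi> \<circ> tr_act n v) (?g y)" if "y \<in> tuples n" for y
        using that v map_permutation_tuples[OF v that] by (simp add: \<phi>_gen tr_act_gen conj_by_delta)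
    qed
    then have "conj_by n v (\<phi> a) = \<phi> (tr_act n v a)" by simp
    then show ?thesis
      using conj_by_eq_iff[OF v hom_in_carrier[OF \<phi> a] hom_in_carrier[OF \<phi> action.act_closed[OF that(2) a]]]
      by simp
  qed
  define \<Theta> where "\<Theta> = (\<lambda>(a, v). \<phi> a \<otimes>\<^bsub>VJ n\<^esub> iota_S n v)"
  have \<Theta>: "\<Theta> \<in> hom action.AB (VJ n)"
    unfolding \<Theta>_def by (rule action.semidirect_hom[OF group_VJ \<phi> iota_S_hom equivariant])
  have \<Theta>\<Psi>: "\<Theta> (\<Psi> g) = g" if g: "g \<in> carrier (VJ n)" for g
  proof -
    have "(\<Theta> \<circ> \<Psi>) g = id g"
    proof (rule V.hom_eq_on_generators[OF generate_vj_gen group_VJ _ _ _ g])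
      show "\<Theta> \<circ> \<Psi> \<in> hom (VJ n) (VJ n)" by (rule Group.hom_compose[OF \<Psi> \<Theta>])
      show "id \<in> hom (VJ n) (VJ n)" by (simp add: hom_def)
      fix l assume l: "l \<in> vj_letters n"
      show "(\<Theta> \<circ> \<Psi>) (vj_gen n l) = id (vj_gen n l)"
      proof (cases l)
        case (X p q)
        then have pq: "1 \<le> p" "p < q" "q \<le> n" using l by auto
        have "\<Theta> (\<Psi> (vj_gen n (X p q))) = delta n (interval p q) \<otimes>\<^bsub>VJ n\<^esub> iota_S n id"
          unfolding \<Psi>_X[OF pq] \<Theta>_def using \<phi>_gen[OF interval_tuples[OF pq]] by simp
        then show ?thesis unfolding iota_S_id delta_interval[OF pq] using X pq by simp
      next
        case (Rho i)
        then have i: "1 \<le> i" "i < n" using l by auto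
        have "\<phi> \<one>\<^bsub>Tr n\<^esub> = \<one>\<^bsub>VJ n\<^esub>" by (rule hom_one[OF \<phi> group_Tr group_VJ])
        then show ?thesis using i Rho by (simp add: \<Psi>_Rho \<Theta>_def iota_S_adj)
      qed
    qed
    then show ?thesis by simp
  qed
  have \<Psi>_iota: "\<Psi> (iota_S n v) = (\<one>\<^bsub>Tr n\<^esub>, v)" if v: "v \<in> carrier ?S" for v
  proof -
    have "(\<Psi> \<circ> iota_S n) v = (\<one>\<^bsub>Tr n\<^esub>, v)"
    proof (rule S.hom_eq_on_generators[OF generate_adj P.is_group _ action.semidirect_snd_hom _ v])
      show "\<Psi> \<circ> iota_S n \<in> hom ?S action.AB" by (rule Group.hom_compose[OF iota_S_hom \<Psi>])
      show "(\<Psi> \<circ> iota_S n) (adj i) = (\<one>\<^bsub>Tr n\<^esub>, adj i)" if "i \<in> {1..<n}" for i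
        using that by (simp add: iota_S_adj \<Psi>_Rho)
    qed
    then show ?thesis by simp
  qed
  have \<Psi>\<phi>: "\<Psi> (\<phi> a) = (a, id)" if a: "a \<in> carrier (Tr n)" for a
  proof -
    have "(\<Psi> \<circ> \<phi>) a = (a, \<one>\<^bsub>?S\<^esub>)"
    proof (rule Tr_hom_eq[OF P.is_group _ action.semidirect_fst_hom _ a])
      show "\<Psi> \<circ> \<phi> \<in> hom (Tr n) action.AB" by (rule Group.hom_compose[OF \<phi> \<Psi>])
      fix y assume y: "y \<in> tuples n"
      obtain w where w: "w permutes {1..n}" "\<forall>i\<in>{1..length y}. w i = y ! (i - 1)"
        by (rule tuple_permutation[OF y]) blast
      have w': "w \<in> carrier ?S" using w(1) by (simp add: sym_group_carrier)
      have l: "1 \<le> (1::nat)" "1 < length y" "length y \<le> n" using y by (auto simp: tuples_def)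
      have yw: "map w (interval 1 (length y)) = y"
        using segment_eq_map_interval[OF w(2), of 1 "length y"] segment_full[of y] by simp
      have gc: "?g (interval 1 (length y)) \<in> carrier (Tr n)" "?g y \<in> carrier (Tr n)"
        using trickle_gen_closed interval_tuples[OF l] y by auto
      have act: "tr_act n w (?g (interval 1 (length y))) = ?g y"
        using tr_act_gen[OF w(1) interval_tuples[OF l]] yw by simp
      \<comment> \<open>Apply \<open>\<Psi>\<close> to \<open>\<delta>\<^sub>y \<iota>\<^sub>S(w) = \<iota>\<^sub>S(w) x\<^sub>1\<^sub>,\<^sub>l\<close>: on the right the interval is carried to
        \<open>y\<close>, and the factor \<open>w\<close> cancels.\<close>
      have "\<phi> (?g y) \<otimes>\<^bsub>VJ n\<^esub> iota_S n w = iota_S n w \<otimes>\<^bsub>VJ n\<^esub> vj_gen n (X 1 (length y))"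
        using conj_by_eq_iff[OF w(1) vj_X_closed[OF l] delta_closed[OF y]] delta_eq[OF y w] \<phi>_gen[OF y]
        by simp
      then have "\<Psi> (\<phi> (?g y)) \<otimes>\<^bsub>action.AB\<^esub> (\<one>\<^bsub>Tr n\<^esub>, w) =
          (\<one>\<^bsub>Tr n\<^esub>, w) \<otimes>\<^bsub>action.AB\<^esub> (?g (interval 1 (length y)), id)"
        using hom_mult[OF \<Psi> hom_in_carrier[OF \<phi> gc(2)] iota_S_closed[OF w(1)]]
          hom_mult[OF \<Psi> iota_S_closed[OF w(1)] vj_X_closed[OF l]] \<Psi>_iota[OF w'] \<Psi>_X[OF l]
        by simp
      also have "\<dots> = (?g y, id) \<otimes>\<^bsub>action.AB\<^esub> (\<one>\<^bsub>Tr n\<^esub>, w)"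
        unfolding semidirect_simps act sym_group_mult
        using gc(2) action.act_one[of id] by (simp add: sym_group_carrier permutes_id)
      finally have "\<Psi> (\<phi> (?g y)) \<otimes>\<^bsub>action.AB\<^esub> (\<one>\<^bsub>Tr n\<^esub>, w) =
          (?g y, id) \<otimes>\<^bsub>action.AB\<^esub> (\<one>\<^bsub>Tr n\<^esub>, w)" .
      moreover have "(\<one>\<^bsub>Tr n\<^esub>, w) \<in> carrier action.AB" "(?g y, id) \<in> carrier action.AB"
        using w' gc(2) by (simp_all add: sym_group_carrier permutes_id)
      moreover have "\<Psi> (\<phi> (?g y)) \<in> carrier action.AB"
        by (rule hom_in_carrier[OF \<Psi> hom_in_carrier[OF \<phi> gc(2)]])
      ultimately have "\<Psi> (\<phi> (?g y)) = (?g y, id)" by (simp only: P.right_cancel)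
      then show "(\<Psi> \<circ> \<phi>) (?g y) = (?g y, \<one>\<^bsub>?S\<^esub>)" by (simp add: sym_group_one)
    qed
    then show ?thesis by (simp add: sym_group_one)
  qed
  have pi_hom: "snd \<circ> \<Psi> \<in> hom (VJ n) ?S" by (rule Group.hom_compose[OF \<Psi> action.semidirect_proj_hom])
  have pi: "pi_K n = restrict (snd \<circ> \<Psi>) (carrier (VJ n))"
    unfolding pi_K_def
  proof (rule V.the_hom_eq[OF generate_vj_gen S.is_group pi_hom])
    show "(snd \<circ> \<Psi>) (vj_gen n l) = pi_K_letter l" if "l \<in> vj_letters n" for l
      using that by (cases l) (auto simp: \<Psi>_X \<Psi>_Rho simp del: upt_Suc)
  qed
  then have kernel: "kernel (VJ n) ?S (pi_K n) = {g \<in> carrier (VJ n). snd (\<Psi> g) = id}"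
    by (auto simp: kernel_def sym_group_one)
  have "group_hom (VJ n) ?S (snd \<circ> \<Psi>)"
    using pi_hom V.is_group S.is_group by (simp add: group_hom_def group_hom_axioms_def)
  from group_hom.subgroup_kernel[OF this]
  have "subgroup (kernel (VJ n) ?S (pi_K n)) (VJ n)"
    unfolding kernel by (simp add: kernel_def sym_group_one)
  then have group_KVJ: "group (KVJ n)" unfolding KVJ_def by (rule V.subgroup_imp_group)
  have KVJ: "carrier (KVJ n) = {g \<in> carrier (VJ n). snd (\<Psi> g) = id}" "mult (KVJ n) = mult (VJ n)"
    by (simp_all add: KVJ_def kernel)
  have \<phi>_K: "\<phi> \<in> hom (Tr n) (KVJ n)"
    using \<phi> \<Psi>\<phi> by (auto simp: hom_def KVJ)
  have Phi: "Phi n = restrict \<phi> (carrier (Tr n))"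
    unfolding Phi_def by (rule T.the_hom_eq[OF generate_trickle_gen group_KVJ \<phi>_K \<phi>_gen])
  have "Phi n (?g y) = delta n y" if "y \<in> tuples n" for y
    using that by (simp add: Phi \<phi>_gen trickle_gen_closed)
  moreover have "Phi n \<in> hom (Tr n) (KVJ n)"
    using \<phi>_K by (auto simp: Phi hom_def)
  moreover have "bij_betw (Phi n) (carrier (Tr n)) (carrier (KVJ n))"
  proof (rule bij_betw_byWitness[where f' = "fst \<circ> \<Psi>"])
    show "\<forall>a\<in>carrier (Tr n). (fst \<circ> \<Psi>) (Phi n a) = a" by (simp add: Phi \<Psi>\<phi>)
    have "fst (\<Psi> g) \<in> carrier (Tr n) \<and> \<phi> (fst (\<Psi> g)) = g" if g: "g \<in> carrier (KVJ n)" for g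
    proof -
      obtain a where a: "\<Psi> g = (a, id)" using g by (cases "\<Psi> g") (auto simp: KVJ)
      have "(a, id) \<in> carrier action.AB" using g a hom_in_carrier[OF \<Psi>, of g] by (simp only: KVJ mem_Collect_eq)
      then have "a \<in> carrier (Tr n)" by simp
      moreover have "g = \<phi> a \<otimes>\<^bsub>VJ n\<^esub> iota_S n id" using \<Theta>\<Psi>[of g] g a by (simp add: KVJ \<Theta>_def)
      ultimately show ?thesis unfolding iota_S_id using a hom_in_carrier[OF \<phi>] by simp
    qed
    then show "\<forall>g\<in>carrier (KVJ n). Phi n ((fst \<circ> \<Psi>) g) = g"
      and "(fst \<circ> \<Psi>) ` carrier (KVJ n) \<subseteq> carrier (Tr n)"
      by (auto simp: Phi)
    show "Phi n ` carrier (Tr n) \<subseteq> carrier (KVJ n)"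
      using \<phi>_K by (auto simp: Phi hom_def)
  qed
  ultimately show ?thesis by (simp add: iso_def)
qed

end
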